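(* Let $1\le k<n-1$, and let $R_k g$ be the $k$-plane transform of a continuous function $g$ on $\mathbb R^n$ satisfying $$|x|^{\lambda}|g(x)|\le c\qquad\text{for all } x\in\mathbb R^n,\ \text{for some } \lambda>k \text{ and some constant } c .$$ Then for any $r>0$ the following implication holds: $$(R_k g)(\zeta)=0\ \ \forall\,\zeta\in G(n,k)\text{ with }|\zeta|>r\ \Longrightarrow\ g(x)=0\ \ \forall\, x\in\mathbb R^n\text{ with }|x|>r .$$
   Context: $G(n,k)$ is the manifold of all $k$-dimensional affine planes $\zeta$ in $\mathbb R^n$; $|\zeta|$ denotes the Euclidean distance from $\zeta$ to the origin. The $k$-plane (Radon-John) transform is $(R_k g)(\zeta)=\int_\zeta g(x)\,d_\zeta x$, $\zeta\in G(n,k)$, where $d_\zeta x$ is the Euclidean volume element on $\zeta$. *)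

theory Defs
  imports "HOL-Analysis.Analysis"
begin

text \<open>The manifold $G(n,k)$ of $k$-dimensional affine planes, as sets of points.\<close>

definition affine_Grassmannian :: "nat \<Rightarrow> 'a::euclidean_space set set" where
  "affine_Grassmannian k = {\<zeta>. affine \<zeta> \<and> aff_dim \<zeta> = int k}"

definition plane_frame :: "'a::euclidean_space set \<Rightarrow> 'a \<Rightarrow> 'a set \<Rightarrow> bool" where
  "plane_frame \<zeta> p B \<longleftrightarrow>
     pairwise orthogonal B \<and> (\<forall>b\<in>B. norm b = 1) \<and> \<zeta> = (+) p ` span B"

text \<open>
  Lebesgue measure in the Cartesian coordinates given by the base point \<open>p\<close> and the
  orthonormal set \<open>B\<close>, as a Borel measure on the ambient space concentrated on the plane
  \<open>p + span B\<close>. For \<open>p = 0\<close> and \<open>B = Basis\<close> this is \<open>lborel_eq\<close>.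
\<close>

definition frame_measure :: "'a::euclidean_space \<Rightarrow> 'a set \<Rightarrow> 'a measure" where
  "frame_measure p B = distr (\<Pi>\<^sub>M b\<in>B. lborel) borel (\<lambda>t. p + (\<Sum>b\<in>B. t b *\<^sub>R b))"

text \<open>
  The Euclidean volume on an affine plane \<open>\<zeta>\<close>. It does not depend on the frame: see
  \<open>plane_measure_eq\<close> and \<open>plane_frame_exists\<close> below.
\<close>

definition plane_measure :: "'a::euclidean_space set \<Rightarrow> 'a measure" where
  "plane_measure \<zeta> = (THE \<mu>. \<exists>p B. plane_frame \<zeta> p B \<and> \<mu> = frame_measure p B)"

text \<open>
  The dimension \<open>k\<close> is determined by the plane, so that $R_k g$ is the restriction of this
  function to \<open>affine_Grassmannian k\<close>.
\<close>

definition plane_transform ::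
    "('a::euclidean_space \<Rightarrow> 'b::{banach, second_countable_topology}) \<Rightarrow> 'a set \<Rightarrow> 'b" where
  "plane_transform g \<zeta> = (LINT x|plane_measure \<zeta>. g x)"

lemma plane_frame_exists:
  assumes "affine \<zeta>" "\<zeta> \<noteq> {}"
  shows "\<exists>p B. plane_frame \<zeta> p B"
proof -
  obtain p where p: "p \<in> \<zeta>" using assms by auto
  define S where "S = (\<lambda>x. x - p) ` \<zeta>"
  have S: "subspace S"
    unfolding S_def using affine_diffs_subspace_subtract[OF assms(1) p] by simp
  obtain B where "pairwise orthogonal B" "\<And>x. x \<in> B \<Longrightarrow> norm x = 1" "span B = S"
    using orthonormal_basis_subspace[OF S] by metis
  moreover have "\<zeta> = (+) p ` S" by (auto simp: S_def image_iff)
  ultimately show ?thesis unfolding plane_frame_def by metis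
qed

lemma lborel_distr_orthogonal:
  fixes T :: "'a::euclidean_space \<Rightarrow> 'a"
  assumes T: "orthogonal_transformation T"
  shows "distr lborel borel T = lborel"
proof -
  have lin: "linear T" using T orthogonal_transformation_linear by blast
  have Tm[measurable]: "T \<in> borel_measurable borel"
    using lin by (simp add: borel_measurable_continuous_onI linear_continuous_on linear_conv_bounded_linear)
  have nT: "norm (T x) = norm x" for x using T by (simp add: orthogonal_transformation_norm)
  have surj: "surj T" using T by (rule orthogonal_transformation_surj)
  define \<nu> where "\<nu> = distr lborel borel T"
  have sets_\<nu>[measurable_cong, simp]: "sets \<nu> = sets borel" by (simp add: \<nu>_def)
  have shift: "distr \<nu> borel ((+) c) = \<nu>" for c
  proof -
    obtain d where d: "c = T d" using surj by (metis surjD)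
    have "distr \<nu> borel ((+) c) = distr lborel borel (\<lambda>x. T (d + x))"
      unfolding \<nu>_def d by (subst distr_distr) (auto simp: comp_def linear_add[OF lin])
    also have "\<dots> = distr (distr lborel borel ((+) d)) borel T"
      by (subst distr_distr) (auto simp: comp_def)
    finally show ?thesis by (simp add: \<nu>_def lborel_distr_plus)
  qed
  have shift_nn: "(\<integral>\<^sup>+x. f (c + x) \<partial>\<nu>) = (\<integral>\<^sup>+x. f x \<partial>\<nu>)" if "f \<in> borel_measurable borel" for f c
  proof -
    have "(\<integral>\<^sup>+x. f x \<partial>\<nu>) = (\<integral>\<^sup>+x. f x \<partial>distr \<nu> borel ((+) c))" by (simp add: shift)
    also have "\<dots> = (\<integral>\<^sup>+x. f (c + x) \<partial>\<nu>)" using that by (intro nn_integral_distr) auto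
    finally show ?thesis by simp
  qed
  have shift_nl: "(\<integral>\<^sup>+x. f (c + x) \<partial>lborel) = (\<integral>\<^sup>+x. f x \<partial>lborel)"
    if "f \<in> borel_measurable borel" for f and c :: 'a
  proof -
    have "(\<integral>\<^sup>+x. f x \<partial>lborel) = (\<integral>\<^sup>+x. f x \<partial>distr lborel borel ((+) c))"
      by (simp add: lborel_distr_plus)
    also have "\<dots> = (\<integral>\<^sup>+x. f (c + x) \<partial>lborel)" using that by (intro nn_integral_distr) auto
    finally show ?thesis by simp
  qed
  have vb: "emeasure \<nu> (ball 0 R) = emeasure lborel (ball (0::'a) R)" for R
  proof -
    have "T -` ball 0 R = ball 0 R" by (auto simp: nT)
    then show ?thesis unfolding \<nu>_def by (subst emeasure_distr) auto
  qed
  have vball: "emeasure \<nu> (ball y 1) = emeasure lborel (ball (0::'a) 1)" for y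
  proof -
    have "(+) y -` ball y 1 = ball 0 (1::real)" by (auto simp: dist_norm)
    moreover have "emeasure \<nu> (ball y 1) = emeasure (distr \<nu> borel ((+) y)) (ball y 1)"
      by (simp add: shift)
    ultimately show ?thesis
      by (simp add: emeasure_distr vb sets_eq_imp_space_eq[OF sets_\<nu>])
  qed
  have "sigma_finite_measure \<nu>"
  proof
    show "\<exists>A. countable A \<and> A \<subseteq> sets \<nu> \<and> \<Union> A = space \<nu> \<and> (\<forall>a\<in>A. emeasure \<nu> a \<noteq> \<infinity>)"
    proof (intro exI conjI)
      show "countable (range (\<lambda>n::nat. ball (0::'a) n))" by simp
      have "\<exists>n::nat. norm x < n" for x :: 'a by (rule reals_Archimedean2)
      then show "\<Union> (range (\<lambda>n::nat. ball (0::'a) n)) = space \<nu>"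
        by (auto simp: sets_eq_imp_space_eq[OF sets_\<nu>])
      show "\<forall>a\<in>range (\<lambda>n::nat. ball (0::'a) n). emeasure \<nu> a \<noteq> \<infinity>"
        using emeasure_bounded_finite[of "ball (0::'a) _"] by (auto simp: vb less_top)
    qed auto
  qed
  then interpret N: sigma_finite_measure \<nu> .
  interpret L: sigma_finite_measure "lborel :: 'a measure" by (rule sigma_finite_lborel)
  interpret NL: pair_sigma_finite \<nu> "lborel :: 'a measure" ..
  have "emeasure \<nu> A = emeasure lborel A" if A[measurable]: "A \<in> sets borel" for A
  proof -
    let ?B = "ball (0::'a) 1" let ?I = "indicator :: 'a set \<Rightarrow> 'a \<Rightarrow> ennreal"
    have [measurable]: "?B \<in> sets borel" by simp
    have "emeasure lborel ?B * emeasure \<nu> A = (\<integral>\<^sup>+y. ?I ?B y * emeasure \<nu> A \<partial>lborel)"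
      by (subst nn_integral_multc) auto
    also have "\<dots> = (\<integral>\<^sup>+y. ?I ?B y * (\<integral>\<^sup>+x. ?I A (y + x) \<partial>\<nu>) \<partial>lborel)"
      by (subst shift_nn) auto
    also have "\<dots> = (\<integral>\<^sup>+y. \<integral>\<^sup>+x. ?I ?B y * ?I A (y + x) \<partial>\<nu> \<partial>lborel)"
      by (intro nn_integral_cong nn_integral_cmult[symmetric]) measurable
    also have "\<dots> = (\<integral>\<^sup>+x. \<integral>\<^sup>+y. ?I ?B y * ?I A (y + x) \<partial>lborel \<partial>\<nu>)"
      by (rule NL.Fubini') measurable
    also have "\<dots> = (\<integral>\<^sup>+x. \<integral>\<^sup>+y. ?I ?B (y - x) * ?I A y \<partial>lborel \<partial>\<nu>)"
    proof (rule nn_integral_cong)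
      fix x :: 'a
      show "(\<integral>\<^sup>+y. ?I ?B y * ?I A (y + x) \<partial>lborel) = (\<integral>\<^sup>+y. ?I ?B (y - x) * ?I A y \<partial>lborel)"
        using shift_nl[of "\<lambda>y. ?I ?B (y - x) * ?I A y" x] by (simp add: add.commute)
    qed
    also have "\<dots> = (\<integral>\<^sup>+y. \<integral>\<^sup>+x. ?I ?B (y - x) * ?I A y \<partial>\<nu> \<partial>lborel)"
      by (rule NL.Fubini'[symmetric]) measurable
    also have "\<dots> = (\<integral>\<^sup>+y. \<integral>\<^sup>+x. ?I (ball y 1) x * ?I A y \<partial>\<nu> \<partial>lborel)"
      by (intro nn_integral_cong) (auto simp: indicator_def dist_norm norm_minus_commute)
    also have "\<dots> = (\<integral>\<^sup>+y. emeasure lborel ?B * ?I A y \<partial>lborel)"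
      by (intro nn_integral_cong) (subst nn_integral_multc, simp_all add: vball borel_measurable_indicator measurable_cong_sets[OF sets_\<nu> refl])
    also have "\<dots> = emeasure lborel ?B * emeasure lborel A"
      by (subst nn_integral_cmult) auto
    finally have eq: "emeasure lborel ?B * emeasure \<nu> A = emeasure lborel ?B * emeasure lborel A" .
    have "emeasure lborel ?B \<noteq> 0"
      using open_not_negligible[of ?B] by (auto simp: negligible_iff_null_sets null_sets_def)
    moreover have "emeasure lborel ?B \<noteq> top"
      using emeasure_bounded_finite[of ?B] by (auto simp: less_top)
    ultimately show ?thesis using eq by (metis ennreal_mult_cancel_left)
  qed
  then have "\<nu> = lborel" by (intro measure_eqI) auto
  then show ?thesis by (simp add: \<nu>_def)
qed

lemma orthonormal_imp_independent:
  fixes B :: "'a::euclidean_space set"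
  assumes "pairwise orthogonal B" "\<forall>b\<in>B. norm b = 1"
  shows "independent B" "finite B"
proof -
  show "independent B" using assms by (intro pairwise_orthogonal_independent) auto
  then show "finite B" using independent_imp_finite by blast
qed

lemma frame_measure_UNIV:
  fixes E :: "'a::euclidean_space set"
  assumes E: "pairwise orthogonal E" "\<forall>b\<in>E. norm b = 1" and sp: "span E = UNIV"
  shows "frame_measure p E = lborel"
proof -
  note ind = orthonormal_imp_independent[OF E]
  have "card E = card (Basis :: 'a set)"
    using ind sp by (metis basis_card_eq_dim dim_UNIV top_greatest)
  then obtain f where f: "bij_betw f (Basis :: 'a set) E"
    using ind by (metis bij_betw_iff_card finite_Basis)
  have inn: "f b \<bullet> f b' = (if b = b' then 1 else 0)" if "b \<in> Basis" "b' \<in> Basis" for b b'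
    using that E f unfolding pairwise_def orthogonal_def bij_betw_def inj_on_def
    by (cases "b = b'") (auto simp: norm_eq_1, metis)
  define T where "T x = (\<Sum>b\<in>Basis. (x \<bullet> b) *\<^sub>R f b)" for x
  have lin: "linear T" unfolding T_def
    by (intro linearI) (simp_all add: inner_add_left scaleR_add_left sum.distrib scaleR_sum_right)
  have "T v \<bullet> T w = v \<bullet> w" for v w
  proof -
    have "T v \<bullet> T w = (\<Sum>b\<in>Basis. \<Sum>b'\<in>Basis. (v \<bullet> b) * ((w \<bullet> b') * (f b \<bullet> f b')))"
    proof -
      have "T v \<bullet> T w = (\<Sum>b\<in>Basis. ((v \<bullet> b) *\<^sub>R f b) \<bullet> T w)"
        by (subst T_def) (rule inner_sum_left)
      also have "\<dots> = (\<Sum>b\<in>Basis. \<Sum>b'\<in>Basis. ((v \<bullet> b) *\<^sub>R f b) \<bullet> ((w \<bullet> b') *\<^sub>R f b'))"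
        by (intro sum.cong refl) (subst T_def, rule inner_sum_right)
      also have "\<dots> = (\<Sum>b\<in>Basis. \<Sum>b'\<in>Basis. (v \<bullet> b) * ((w \<bullet> b') * (f b \<bullet> f b')))"
        by (simp only: inner_scaleR_left inner_scaleR_right mult.left_commute)
      finally show ?thesis .
    qed
    also have "\<dots> = (\<Sum>b\<in>Basis. \<Sum>b'\<in>Basis. if b = b' then (v \<bullet> b) * (w \<bullet> b') else 0)"
      by (intro sum.cong refl) (auto simp: inn)
    also have "\<dots> = (\<Sum>b\<in>Basis. (v \<bullet> b) * (w \<bullet> b))"
      by (intro sum.cong refl) simp
    also have "\<dots> = v \<bullet> w" by (rule euclidean_inner[symmetric])
    finally show ?thesis .
  qed
  then have T: "orthogonal_transformation T"
    using lin unfolding orthogonal_transformation_def by blast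
  interpret P: product_sigma_finite "\<lambda>_::'a. lborel :: real measure" by standard
  have re: "distr (\<Pi>\<^sub>M e\<in>E. lborel) (\<Pi>\<^sub>M b\<in>Basis. lborel) (\<lambda>t. \<lambda>b\<in>Basis. t (f b))
      = (\<Pi>\<^sub>M b\<in>Basis. (lborel :: real measure))"
  proof (rule P.PiM_eqI)
    fix A :: "'a \<Rightarrow> real set" assume A: "\<And>i. i \<in> Basis \<Longrightarrow> A i \<in> sets lborel"
    define g where "g = the_inv_into Basis f"
    have gf: "g (f b) = b" if "b \<in> Basis" for b
      using f that unfolding g_def by (simp add: bij_betw_def the_inv_into_f_f)
    have fb: "f b \<in> E" if "b \<in> Basis" for b using f that by (auto simp: bij_betw_def)
    have gb: "g e \<in> Basis" "f (g e) = e" if "e \<in> E" for e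
      using f that unfolding g_def
      by (auto simp: bij_betw_def f_the_inv_into_f intro!: the_inv_into_into)
    have meas: "(\<lambda>t. \<lambda>b\<in>Basis. t (f b)) \<in> (\<Pi>\<^sub>M e\<in>E. lborel :: real measure) \<rightarrow>\<^sub>M (\<Pi>\<^sub>M b\<in>Basis. lborel)"
      by (intro measurable_restrict measurable_component_singleton fb)
    have vim: "(\<lambda>t. \<lambda>b\<in>Basis. t (f b)) -` (Pi\<^sub>E Basis A) \<inter> space (\<Pi>\<^sub>M e\<in>E. lborel :: real measure)
        = Pi\<^sub>E E (\<lambda>e. A (g e))"
    proof (rule set_eqI)
      fix t :: "'a \<Rightarrow> real"
      have "(\<forall>b\<in>Basis. t (f b) \<in> A b) \<longleftrightarrow> (\<forall>e\<in>E. t e \<in> A (g e))"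
        using gf fb gb by metis
      then show "t \<in> (\<lambda>t. \<lambda>b\<in>Basis. t (f b)) -` (Pi\<^sub>E Basis A) \<inter> space (\<Pi>\<^sub>M e\<in>E. lborel :: real measure)
          \<longleftrightarrow> t \<in> Pi\<^sub>E E (\<lambda>e. A (g e))"
        by (simp add: space_PiM PiE_iff conj_commute)
    qed
    have "emeasure (distr (\<Pi>\<^sub>M e\<in>E. lborel) (\<Pi>\<^sub>M b\<in>Basis. lborel) (\<lambda>t. \<lambda>b\<in>Basis. t (f b))) (Pi\<^sub>E Basis A)
        = emeasure (\<Pi>\<^sub>M e\<in>E. lborel) (Pi\<^sub>E E (\<lambda>e. A (g e)))"
      using A by (subst emeasure_distr[OF meas]) (auto simp: vim intro!: sets_PiM_I_finite)
    also have "\<dots> = (\<Prod>e\<in>E. emeasure lborel (A (g e)))"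
      using ind A gb by (intro P.emeasure_PiM) auto
    also have "\<dots> = (\<Prod>b\<in>Basis. emeasure lborel (A (g (f b))))"
      by (rule prod.reindex_bij_betw[OF f, symmetric])
    also have "\<dots> = (\<Prod>b\<in>Basis. emeasure lborel (A b))"
      by (intro prod.cong) (auto simp: gf)
    finally show "emeasure (distr (\<Pi>\<^sub>M e\<in>E. lborel) (\<Pi>\<^sub>M b\<in>Basis. lborel) (\<lambda>t. \<lambda>b\<in>Basis. t (f b))) (Pi\<^sub>E Basis A)
       = (\<Prod>b\<in>Basis. emeasure lborel (A b))" .
  qed simp_all
  have fb: "f b \<in> E" if "b \<in> Basis" for b using f that by (auto simp: bij_betw_def)
  have meas: "(\<lambda>t. \<lambda>b\<in>Basis. t (f b)) \<in> (\<Pi>\<^sub>M e\<in>E. lborel :: real measure) \<rightarrow>\<^sub>M (\<Pi>\<^sub>M b\<in>Basis. lborel)"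
    by (intro measurable_restrict measurable_component_singleton fb)
  have Tm[measurable]: "T \<in> borel_measurable borel"
    using lin by (simp add: borel_measurable_continuous_onI linear_continuous_on linear_conv_bounded_linear)
  have sm[measurable]: "(\<lambda>t. \<Sum>b\<in>Basis. t b *\<^sub>R b) \<in> borel_measurable (\<Pi>\<^sub>M b\<in>(Basis :: 'a set). (lborel :: real measure))"
    by measurable
  have "lborel = distr (distr lborel borel T) borel ((+) p)"
    by (simp add: lborel_distr_orthogonal[OF T] lborel_distr_plus)
  also have "\<dots> = distr lborel borel (\<lambda>x. p + T x)"
    by (subst distr_distr) (auto simp: comp_def)
  also have "\<dots> = distr (distr (distr (\<Pi>\<^sub>M e\<in>E. lborel) (\<Pi>\<^sub>M b\<in>Basis. lborel) (\<lambda>t. \<lambda>b\<in>Basis. t (f b)))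
        borel (\<lambda>t. \<Sum>b\<in>Basis. t b *\<^sub>R b)) borel (\<lambda>x. p + T x)"
    unfolding re lborel_eq[symmetric] ..
  also have "\<dots> = distr (\<Pi>\<^sub>M e\<in>E. lborel) borel (\<lambda>t. p + T (\<Sum>b\<in>Basis. t (f b) *\<^sub>R b))"
  proof -
    have pT: "(\<lambda>x. p + T x) \<in> borel \<rightarrow>\<^sub>M borel" by measurable
    show ?thesis
      unfolding distr_distr[OF sm meas] distr_distr[OF pT measurable_comp[OF meas sm]]
      by (simp add: comp_def)
  qed
  also have "\<dots> = frame_measure p E"
  proof -
    have "T (\<Sum>b\<in>Basis. t (f b) *\<^sub>R b) = (\<Sum>e\<in>E. t e *\<^sub>R e)" for t
    proof -
      have "T (\<Sum>b\<in>Basis. t (f b) *\<^sub>R b) = (\<Sum>b\<in>Basis. t (f b) *\<^sub>R f b)"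
        unfolding T_def by (intro sum.cong refl) (simp add: inner_sum_left_Basis)
      also have "\<dots> = (\<Sum>e\<in>E. t e *\<^sub>R e)"
        by (rule sum.reindex_bij_betw[OF f])
      finally show ?thesis .
    qed
    then show ?thesis unfolding frame_measure_def by simp
  qed
  finally show ?thesis by simp
qed

text \<open>
  The volume of \<open>A\<close> in the plane is the \<open>n\<close>-dimensional volume of the set of points that
  project into \<open>A\<close> and have coordinates in the unit interval along an orthonormal set \<open>D\<close>
  spanning the orthogonal complement.
\<close>

lemma emeasure_frame_measure:
  fixes B D :: "'a::euclidean_space set"
  assumes B: "pairwise orthogonal B" "\<forall>b\<in>B. norm b = 1"
    and D: "pairwise orthogonal D" "\<forall>d\<in>D. norm d = 1"
    and BD: "\<And>b d. b \<in> B \<Longrightarrow> d \<in> D \<Longrightarrow> b \<bullet> d = 0"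
    and sp: "span (B \<union> D) = UNIV"
    and A: "A \<in> sets borel"
  shows "emeasure (frame_measure p B) A =
    emeasure lborel {x. x - (\<Sum>d\<in>D. ((x - p) \<bullet> d) *\<^sub>R d) \<in> A \<and> (\<forall>d\<in>D. (x - p) \<bullet> d \<in> {0..1})}"
    (is "_ = emeasure lborel ?W")
proof -
  note fB = orthonormal_imp_independent(2)[OF B] and fD = orthonormal_imp_independent(2)[OF D]
  have disj: "B \<inter> D = {}"
    using BD B by (metis disjoint_iff inner_eq_zero_iff norm_zero zero_neq_one)
  have BD': "d \<bullet> b = 0" if "b \<in> B" "d \<in> D" for b d using BD[OF that] by (simp add: inner_commute)
  have E: "pairwise orthogonal (B \<union> D)" "\<forall>b\<in>B \<union> D. norm b = 1"
    using B D BD BD' by (auto simp: pairwise_def orthogonal_def)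
  have W: "?W \<in> sets borel"
  proof -
    have "(\<lambda>x. x - (\<Sum>d\<in>D. ((x - p) \<bullet> d) *\<^sub>R d)) \<in> borel_measurable borel" by measurable
    from measurable_sets_borel[OF this A]
    have 1: "{x. x - (\<Sum>d\<in>D. ((x - p) \<bullet> d) *\<^sub>R d) \<in> A} \<in> sets borel" by (simp add: vimage_def)
    have "closed (\<Inter>d\<in>D. {x. 0 \<le> (x - p) \<bullet> d} \<inter> {x. (x - p) \<bullet> d \<le> 1})"
      by (intro closed_INT ballI closed_Int closed_Collect_le continuous_intros)
    then have 2: "(\<Inter>d\<in>D. {x. 0 \<le> (x - p) \<bullet> d} \<inter> {x. (x - p) \<bullet> d \<le> 1}) \<in> sets borel" by simp
    have "?W = {x. x - (\<Sum>d\<in>D. ((x - p) \<bullet> d) *\<^sub>R d) \<in> A} \<inter>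
        (\<Inter>d\<in>D. {x. 0 \<le> (x - p) \<bullet> d} \<inter> {x. (x - p) \<bullet> d \<le> 1})" by auto
    then show ?thesis using 1 2 by simp
  qed
  interpret P: product_sigma_finite "\<lambda>_::'a. lborel :: real measure" by standard
  interpret PB: finite_product_sigma_finite "\<lambda>_::'a. lborel :: real measure" B
    by standard (rule fB)
  interpret PD: finite_product_sigma_finite "\<lambda>_::'a. lborel :: real measure" D
    by standard (rule fD)
  let ?PB = "\<Pi>\<^sub>M b\<in>B. (lborel :: real measure)" and ?PD = "\<Pi>\<^sub>M b\<in>D. (lborel :: real measure)"
    and ?PE = "\<Pi>\<^sub>M b\<in>B \<union> D. (lborel :: real measure)"
  let ?F = "\<lambda>t. p + (\<Sum>b\<in>B \<union> D. t b *\<^sub>R b)"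
  let ?FB = "\<lambda>t. p + (\<Sum>b\<in>B. t b *\<^sub>R b)"
  have Fm: "?F \<in> ?PE \<rightarrow>\<^sub>M borel" by measurable
  have FBm: "?FB \<in> ?PB \<rightarrow>\<^sub>M borel" by measurable
  have coord: "(\<Sum>b\<in>B \<union> D. t b *\<^sub>R b) \<bullet> d = t d" if "d \<in> D" for t d
  proof -
    have "(\<Sum>b\<in>B \<union> D. t b *\<^sub>R b) \<bullet> d = (\<Sum>b\<in>B \<union> D. t b * (b \<bullet> d))" by (simp add: inner_sum_left)
    also have "\<dots> = (\<Sum>b\<in>B \<union> D. if b = d then t b else 0)"
      using that E by (intro sum.cong refl) (auto simp: pairwise_def orthogonal_def norm_eq_1)
    also have "\<dots> = t d" using that fB fD by simp
    finally show ?thesis .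
  qed
  have FW: "?F t \<in> ?W \<longleftrightarrow> ?FB t \<in> A \<and> (\<forall>d\<in>D. t d \<in> {0..1})" for t
  proof -
    have eq: "?F t - (\<Sum>d\<in>D. ((?F t - p) \<bullet> d) *\<^sub>R d) = ?FB t"
      by (simp add: coord add_diff_cancel_left' cong: sum.cong)
         (simp add: sum.union_disjoint[OF fB fD disj])
    show ?thesis unfolding mem_Collect_eq eq by (simp add: coord)
  qed
  have "emeasure lborel ?W = emeasure (frame_measure p (B \<union> D)) ?W"
    by (simp add: frame_measure_UNIV[OF E sp])
  also have "\<dots> = emeasure ?PE (?F -` ?W \<inter> space ?PE)"
    unfolding frame_measure_def by (rule emeasure_distr[OF Fm W])
  also have "\<dots> = emeasure (distr (?PB \<Otimes>\<^sub>M ?PD) ?PE (merge B D)) (?F -` ?W \<inter> space ?PE)"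
    by (simp add: P.distr_merge[OF disj fB fD])
  also have "\<dots> = emeasure (?PB \<Otimes>\<^sub>M ?PD)
      (merge B D -` (?F -` ?W \<inter> space ?PE) \<inter> space (?PB \<Otimes>\<^sub>M ?PD))"
    by (rule emeasure_distr[OF measurable_merge measurable_sets[OF Fm W]])
  also have "merge B D -` (?F -` ?W \<inter> space ?PE) \<inter> space (?PB \<Otimes>\<^sub>M ?PD)
      = (?FB -` A \<inter> space ?PB) \<times> (Pi\<^sub>E D (\<lambda>_. {0..1}))"
  proof -
    have m: "merge B D z \<in> space ?PE" if "z \<in> space (?PB \<Otimes>\<^sub>M ?PD)" for z
      using measurable_space[OF measurable_merge that] .
    have s: "?FB (merge B D (x, y)) = ?FB x" for x y :: "'a \<Rightarrow> real"
      by (simp add: merge_def cong: sum.cong)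
    have t: "merge B D (x, y) d = y d" if "d \<in> D" for x y :: "'a \<Rightarrow> real" and d
      using that disj by (auto simp: merge_def)
    have "z \<in> merge B D -` (?F -` ?W \<inter> space ?PE) \<inter> space (?PB \<Otimes>\<^sub>M ?PD) \<longleftrightarrow>
        z \<in> (?FB -` A \<inter> space ?PB) \<times> (Pi\<^sub>E D (\<lambda>_. {0..1}))" for z
    proof (cases z)
      case (Pair x y)
      have "z \<in> merge B D -` (?F -` ?W \<inter> space ?PE) \<inter> space (?PB \<Otimes>\<^sub>M ?PD) \<longleftrightarrow>
          z \<in> space (?PB \<Otimes>\<^sub>M ?PD) \<and> ?F (merge B D z) \<in> ?W"
        using m by blast
      also have "\<dots> \<longleftrightarrow> z \<in> space (?PB \<Otimes>\<^sub>M ?PD) \<and>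
          ?FB (merge B D z) \<in> A \<and> (\<forall>d\<in>D. merge B D z d \<in> {0..1})"
        by (simp only: FW)
      also have "\<dots> \<longleftrightarrow> z \<in> (?FB -` A \<inter> space ?PB) \<times> (Pi\<^sub>E D (\<lambda>_. {0..1}))"
        unfolding Pair s using t by (auto simp: space_pair_measure space_PiM PiE_iff)
      finally show ?thesis .
    qed
    then show ?thesis by blast
  qed
  also have "emeasure (?PB \<Otimes>\<^sub>M ?PD) ((?FB -` A \<inter> space ?PB) \<times> (Pi\<^sub>E D (\<lambda>_. {0..1})))
      = emeasure ?PB (?FB -` A \<inter> space ?PB) * emeasure ?PD (Pi\<^sub>E D (\<lambda>_. {0..1}))"
    using fD by (intro PD.emeasure_pair_measure_Times measurable_sets[OF FBm A] sets_PiM_I_finite) auto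
  also have "emeasure ?PD (Pi\<^sub>E D (\<lambda>_. {0..1})) = 1"
    using fD by (subst P.emeasure_PiM) auto
  also have "emeasure ?PB (?FB -` A \<inter> space ?PB) = emeasure (frame_measure p B) A"
    unfolding frame_measure_def by (rule emeasure_distr[OF FBm A, symmetric])
  finally show ?thesis by simp
qed

lemma frame_measure_unique:
  fixes \<zeta> :: "'a::euclidean_space set"
  assumes 1: "plane_frame \<zeta> p B" and 2: "plane_frame \<zeta> q C"
  shows "frame_measure p B = frame_measure q C"
proof (rule measure_eqI)
  fix A assume "A \<in> sets (frame_measure p B)"
  then have A: "A \<in> sets borel" by (simp add: frame_measure_def)
  have B: "pairwise orthogonal B" "\<forall>b\<in>B. norm b = 1" and zB: "\<zeta> = (+) p ` span B"
    and C: "pairwise orthogonal C" "\<forall>b\<in>C. norm b = 1" and zC: "\<zeta> = (+) q ` span C"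
    using 1 2 unfolding plane_frame_def by auto
  have "q \<in> (+) p ` span B" using zB zC span_zero[of C] by force
  then have qp: "q - p \<in> span B" by auto
  have "(+) (- p) ` (+) p ` span B = (+) (- p) ` (+) q ` span C" using zB zC by simp
  then have "(+) (q - p) ` span C = span B" by (simp add: image_image algebra_simps)
  then have eq: "span C = span B"
  proof -
    have *: "(+) (q - p) ` span B = span B"
    proof
      show "(+) (q - p) ` span B \<subseteq> span B" using qp by (auto intro: span_add)
      show "span B \<subseteq> (+) (q - p) ` span B"
      proof
        fix x assume "x \<in> span B"
        then have "x - (q - p) \<in> span B" using qp by (rule span_diff)
        then show "x \<in> (+) (q - p) ` span B" by (force simp: image_iff)
      qed
    qed
    have "inj ((+) (q - p))" by simp
    then show ?thesis using \<open>(+) (q - p) ` span C = span B\<close> * by (metis inj_image_eq_iff)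
  qed
  obtain D where D: "pairwise orthogonal D" "\<And>x. x \<in> D \<Longrightarrow> norm x = 1"
      and spD: "span D = (span B)\<^sup>\<bottom>"
    using orthonormal_basis_subspace[OF subspace_orthogonal_comp] by metis
  have perp: "s \<bullet> d = 0" if "s \<in> span B" "d \<in> D" for s d
  proof -
    have "d \<in> (span B)\<^sup>\<bottom>" using that spD span_base by blast
    then show ?thesis using that by (auto simp: orthogonal_comp_def orthogonal_def)
  qed
  have spU: "span (B \<union> D) = UNIV"
    using subspace_sum_orthogonal_comp[of "span B"] spD
    by (simp add: span_Un set_plus_def) (simp add: set_eq_iff, metis)
  have spU': "span (C \<union> D) = UNIV" using spU eq by (simp add: span_Un)
  have shift: "(x - q) \<bullet> d = (x - p) \<bullet> d" if "d \<in> D" for x d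
    using perp[OF qp that] by (simp add: inner_diff_left)
  have "emeasure (frame_measure p B) A = emeasure lborel
      {x. x - (\<Sum>d\<in>D. ((x - p) \<bullet> d) *\<^sub>R d) \<in> A \<and> (\<forall>d\<in>D. (x - p) \<bullet> d \<in> {0..1})}"
    using D perp span_base spU A by (intro emeasure_frame_measure[OF B]) blast+
  also have "\<dots> = emeasure lborel
      {x. x - (\<Sum>d\<in>D. ((x - q) \<bullet> d) *\<^sub>R d) \<in> A \<and> (\<forall>d\<in>D. (x - q) \<bullet> d \<in> {0..1})}"
    by (simp add: shift cong: sum.cong)
  also have "\<dots> = emeasure (frame_measure q C) A"
    using D perp span_base spU' A eq by (intro emeasure_frame_measure[OF C, symmetric]) blast+
  finally show "emeasure (frame_measure p B) A = emeasure (frame_measure q C) A" .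
qed (simp add: frame_measure_def)

theorem plane_measure_eq:
  fixes \<zeta> :: "'a::euclidean_space set"
  assumes "plane_frame \<zeta> p B"
  shows "plane_measure \<zeta> = frame_measure p B"
  unfolding plane_measure_def using assms frame_measure_unique by blast

end

theory Submission
  imports Defs "HOL-Probability.Distributions"
begin

text \<open>
  Because $k < n - 1$, the support statement reduces to injectivity. Given \<open>p\<close> with $|p| > r$,
  there is a $(k+1)$-dimensional plane through \<open>p\<close> that is orthogonal to \<open>p\<close>. Each of its points
  has norm at least $|p| > r$, so \<open>g\<close> has integral zero over every hyperplane of this plane.
  It remains to show that a continuous function \<open>f\<close> on an $m$-dimensional Euclidean space \<open>V\<close>,
  with $m = k + 1$, that is $O(|x|^{-\lambda})$ for some $\lambda > m - 1$ and has all
  hyperplane integrals equal to zero, vanishes at the origin (\<open>hyperplane_transform_injective\<close>).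

  Such an \<open>f\<close> need not be integrable on \<open>V\<close>, which rules out the Fourier slice theorem.
  Instead, slicing orthogonally to $\xi$ gives, for almost every $\xi \in V$,
  $\int_V f(x)\, e^{-\pi (x \cdot \xi)^2} dx = 0$ (\<open>integral_ridge_eq_0\<close>). These identities are
  integrated against $e^{-\pi b |\xi|^2} d\xi$, where $b > 0$. By the Gaussian integral
  \[ \int_V e^{-\pi (b |\xi|^2 + (x \cdot \xi)^2)} d\xi = b^{-(m-1)/2} (b + |x|^2)^{-1/2} \]
  (\<open>gaussian_frame_measure\<close>), Fubini yields $\int_V f(x)\, (b + |x|^2)^{-1/2} dx = 0$ for all
  $b > 0$ (\<open>potential_eq_0\<close>). The kernel decays like $|x|^{-1}$, so this integral converges
  absolutely because $\lambda + 1 > m$.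

  Differentiating $j$ times in $b$ replaces the exponent $-1/2$ by $-1/2 - j$
  (\<open>shifted_power_integral_eq_0_Suc\<close>). For $b = 1$ and $j \to \infty$ the positive weights
  $(1 + |x|^2)^{-1/2-j}$ concentrate at the origin, which forces $f(0) = 0$
  (\<open>concentration_eq_0\<close>).

  Integrals over \<open>V\<close> are taken with respect to \<open>frame_measure 0 E\<close>, where \<open>E\<close> is an orthonormal
  basis of \<open>V\<close>. By rotation invariance (\<open>frame_measure_cong_span\<close>) the basis may be chosen
  anew for each integral, with one vector along the direction that matters.
\<close>

section \<open>Orthonormal sets\<close>

definition orthonormal :: "'a::real_inner set \<Rightarrow> bool" where
  "orthonormal B \<longleftrightarrow> pairwise orthogonal B \<and> (\<forall>b\<in>B. norm b = 1)"

lemma orthonormal_finite: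
  fixes B :: "'a::euclidean_space set"
  assumes "orthonormal B"
  shows "finite B"
  using assms orthonormal_imp_independent(2) unfolding orthonormal_def by blast

lemma orthonormal_independent:
  fixes B :: "'a::euclidean_space set"
  assumes "orthonormal B"
  shows "independent B"
  using assms orthonormal_imp_independent(1) unfolding orthonormal_def by blast

lemma orthonormal_subset: "orthonormal B \<Longrightarrow> C \<subseteq> B \<Longrightarrow> orthonormal C"
  unfolding orthonormal_def by (auto intro: pairwise_mono)

lemma orthonormal_combination_inner:
  fixes B :: "'a::euclidean_space set"
  assumes B: "orthonormal B" and b: "b \<in> B"
  shows "(\<Sum>d\<in>B. t d *\<^sub>R d) \<bullet> b = t b"
proof -
  have "(\<Sum>d\<in>B. t d *\<^sub>R d) \<bullet> b = (\<Sum>d\<in>B. t d * (d \<bullet> b))" by (simp add: inner_sum_left)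
  also have "\<dots> = (\<Sum>d\<in>B. if d = b then t d else 0)"
    using b B unfolding orthonormal_def
    by (intro sum.cong refl) (auto simp: pairwise_def orthogonal_def norm_eq_1)
  also have "\<dots> = t b" using b orthonormal_finite[OF B] by simp
  finally show ?thesis .
qed

lemma orthonormal_combination_norm:
  fixes B :: "'a::euclidean_space set"
  assumes B: "orthonormal B"
  shows "(norm (\<Sum>d\<in>B. t d *\<^sub>R d))\<^sup>2 = (\<Sum>d\<in>B. (t d)\<^sup>2)"
proof -
  have "(norm (\<Sum>d\<in>B. t d *\<^sub>R d))\<^sup>2 = (\<Sum>b\<in>B. t b * ((\<Sum>d\<in>B. t d *\<^sub>R d) \<bullet> b))"
    by (simp add: power2_norm_eq_inner inner_sum_right)
  also have "\<dots> = (\<Sum>d\<in>B. (t d)\<^sup>2)"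
    by (intro sum.cong refl) (simp add: orthonormal_combination_inner[OF B] power2_eq_square)
  finally show ?thesis .
qed

text \<open>
  The first vector is the direction of \<open>x\<close>, or any vector of \<open>E\<close> if \<open>x = 0\<close>; an orthonormal
  basis of its orthogonal complement in \<open>span E\<close> completes it.
\<close>

lemma orthonormal_basis_containing_direction:
  fixes E :: "'a::euclidean_space set"
  assumes E: "orthonormal E" "E \<noteq> {}" and x: "x \<in> span E"
  obtains e B where "orthonormal (insert e B)" "e \<notin> B" "span (insert e B) = span E"
    "card (insert e B) = card E" "x = norm x *\<^sub>R e"
proof -
  obtain e where e: "e \<in> span E" "norm e = 1" "x = norm x *\<^sub>R e"
  proof (cases "x = 0")
    case True
    obtain b where "b \<in> E" using E by auto
    then show ?thesis using that[of b] True E by (auto simp: span_base orthonormal_def)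
  next
    case False
    show ?thesis
      by (rule that[of "x /\<^sub>R norm x"]) (use False x in \<open>auto simp: span_scale\<close>)
  qed
  define V where "V = {y \<in> span E. e \<bullet> y = 0}"
  have "subspace V"
    unfolding V_def subspace_def
    by (auto simp: span_zero span_add span_scale inner_add_right)
  then obtain B where B: "B \<subseteq> V" "pairwise orthogonal B" "\<And>x. x \<in> B \<Longrightarrow> norm x = 1" "span B = V"
    using orthonormal_basis_subspace by metis
  have eB: "e \<notin> B" using B(1) e by (auto simp: V_def)
  have on: "orthonormal (insert e B)"
    using B e unfolding orthonormal_def
    by (auto simp: pairwise_insert V_def orthogonal_def inner_commute)
  have sp: "span (insert e B) = span E"
  proof
    show "span (insert e B) \<subseteq> span E"
      by (rule span_minimal) (use B e in \<open>auto simp: V_def\<close>)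
    show "span E \<subseteq> span (insert e B)"
    proof
      fix y assume y: "y \<in> span E"
      have "y - (e \<bullet> y) *\<^sub>R e \<in> V"
        using y e by (auto simp: V_def span_diff span_scale inner_diff_right norm_eq_1)
      then have "y - (e \<bullet> y) *\<^sub>R e \<in> span B" using B by simp
      then show "y \<in> span (insert e B)" by (auto simp: span_insert)
    qed
  qed
  have "card (insert e B) = card E"
    using sp orthonormal_independent[OF on] orthonormal_independent[OF E(1)]
    by (metis dim_eq_card_independent dim_span)
  with on eB sp e(3) that show ?thesis by blast
qed

section \<open>Lebesgue measure on a subspace\<close>

lemma sets_frame_measure[simp, measurable_cong]: "sets (frame_measure p B) = sets borel"
  by (simp add: frame_measure_def)

lemma space_frame_measure[simp]: "space (frame_measure p B) = UNIV"
  by (simp add: frame_measure_def)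

lemma frame_map_measurable[measurable]:
  fixes p :: "'a::euclidean_space"
  shows
  "(\<lambda>t. p + (\<Sum>b\<in>B. t b *\<^sub>R b)) \<in> borel_measurable (\<Pi>\<^sub>M b\<in>B. (lborel :: real measure))"
  by measurable

lemma integral_frame_measure:
  fixes h :: "'a::euclidean_space \<Rightarrow> 'b::{banach, second_countable_topology}"
  assumes [measurable]: "h \<in> borel_measurable borel"
  shows "integral\<^sup>L (frame_measure p B) h
    = (LINT t|(\<Pi>\<^sub>M b\<in>B. lborel). h (p + (\<Sum>b\<in>B. t b *\<^sub>R b)))"
  unfolding frame_measure_def by (rule integral_distr) measurable

lemma integrable_frame_measure:
  fixes h :: "'a::euclidean_space \<Rightarrow> 'b::{banach, second_countable_topology}"
  assumes [measurable]: "h \<in> borel_measurable borel"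
  shows "integrable (frame_measure p B) h
    \<longleftrightarrow> integrable (\<Pi>\<^sub>M b\<in>B. lborel) (\<lambda>t. h (p + (\<Sum>b\<in>B. t b *\<^sub>R b)))"
  unfolding frame_measure_def by (rule integrable_distr_eq) measurable

lemma integral_frame_measure_translate:
  fixes h :: "'a::euclidean_space \<Rightarrow> 'b::{banach, second_countable_topology}"
  assumes [measurable]: "h \<in> borel_measurable borel"
  shows "(LINT x|frame_measure p B. h (q + x)) = integral\<^sup>L (frame_measure (q + p) B) h"
  by (simp add: integral_frame_measure add.assoc)

text \<open>
  Rotation invariance of Lebesgue measure on a subspace: Cartesian coordinates may be chosen to
  suit the integrand.
\<close>

lemma frame_measure_cong_span:
  fixes B C :: "'a::euclidean_space set"
  assumes "orthonormal B" "orthonormal C" "span B = span C"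
  shows "frame_measure 0 B = frame_measure 0 C"
proof (rule frame_measure_unique)
  show "plane_frame (span B) 0 B" "plane_frame (span B) 0 C"
    using assms by (auto simp: plane_frame_def orthonormal_def)
qed

lemma AE_frame_measure_span: "AE x in frame_measure 0 (B :: 'a::euclidean_space set). x \<in> span B"
  unfolding frame_measure_def
  by (subst AE_distr_iff) (auto intro!: AE_I2 span_sum span_scale intro: span_base)

text \<open>
  The sets on which all coordinates are bounded by $n$ exhaust the whole space, and each meets
  the subspace in a cube.
\<close>

lemma sigma_finite_frame_measure:
  fixes B :: "'a::euclidean_space set"
  assumes B: "orthonormal B"
  shows "sigma_finite_measure (frame_measure 0 B)"
proof
  interpret P: product_sigma_finite "\<lambda>_::'a. lborel :: real measure" by standard
  let ?A = "\<lambda>n::nat. {x. \<forall>b\<in>B. \<bar>x \<bullet> b\<bar> \<le> n}"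
  have clo: "closed (?A n)" for n
  proof -
    have "closed (\<Inter>b\<in>B. {x. \<bar>x \<bullet> b\<bar> \<le> n})"
      by (intro closed_INT ballI closed_Collect_le continuous_intros)
    also have "(\<Inter>b\<in>B. {x. \<bar>x \<bullet> b\<bar> \<le> n}) = ?A n" by auto
    finally show ?thesis .
  qed
  have fin: "emeasure (frame_measure 0 B) (?A n) \<noteq> \<infinity>" for n
  proof -
    have "emeasure (frame_measure 0 B) (?A n)
        = emeasure (\<Pi>\<^sub>M b\<in>B. lborel) (Pi\<^sub>E B (\<lambda>_. {-real n..real n}))"
      unfolding frame_measure_def using clo[of n]
      by (subst emeasure_distr)
         (auto intro!: arg_cong2[where f=emeasure] simp: space_PiM PiE_iff
            orthonormal_combination_inner[OF B] abs_le_iff minus_le_iff Pi_iff)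
    also have "\<dots> = (\<Prod>b\<in>B. emeasure lborel {-real n..real n})"
      using orthonormal_finite[OF B] by (intro P.emeasure_PiM) auto
    also have "\<dots> \<noteq> \<infinity>" by (simp add: ennreal_power)
    finally show ?thesis .
  qed
  have cov: "\<exists>n. x \<in> ?A n" for x
  proof -
    obtain n :: nat where "(\<Sum>b\<in>B. \<bar>x \<bullet> b\<bar>) \<le> n" using real_arch_simple by blast
    moreover have "\<bar>x \<bullet> b\<bar> \<le> (\<Sum>b\<in>B. \<bar>x \<bullet> b\<bar>)" if "b \<in> B" for b
      using that orthonormal_finite[OF B] by (intro member_le_sum) auto
    ultimately show ?thesis by (intro exI[of _ n]) (auto intro: order_trans)
  qed
  show "\<exists>A. countable A \<and> A \<subseteq> sets (frame_measure 0 B) \<and> \<Union> A = space (frame_measure 0 B)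
      \<and> (\<forall>a\<in>A. emeasure (frame_measure 0 B) a \<noteq> \<infinity>)"
  proof (intro exI[of _ "range ?A"] conjI)
    show "\<Union> (range ?A) = space (frame_measure 0 B)" using cov by auto
  qed (use fin clo in auto)
qed

text \<open>
  The ball contains a small coordinate cube.
\<close>

lemma emeasure_frame_measure_cball_pos:
  fixes B :: "'a::euclidean_space set"
  assumes B: "orthonormal B" and "\<delta> > 0"
  shows "emeasure (frame_measure 0 B) (cball 0 \<delta>) > 0"
proof -
  interpret P: product_sigma_finite "\<lambda>_::'a. lborel :: real measure" by standard
  note fin = orthonormal_finite[OF B]
  \<comment> \<open>The summand 1 keeps the side length meaningful for the zero subspace, where \<open>B\<close> is empty.\<close>
  define c where "c = \<delta> / (card B + 1)"
  have c: "c > 0" using assms by (simp add: c_def)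
  have "norm (\<Sum>b\<in>B. t b *\<^sub>R b) \<le> \<delta>" if t: "t \<in> Pi\<^sub>E B (\<lambda>_. {0..c})" for t
  proof -
    have "norm (\<Sum>b\<in>B. t b *\<^sub>R b) \<le> card B * c"
      by (rule sum_norm_bound) (use t B in \<open>auto simp: orthonormal_def PiE_iff\<close>)
    also have "\<dots> \<le> \<delta>" using assms by (simp add: c_def field_simps)
    finally show ?thesis .
  qed
  then have sub: "Pi\<^sub>E B (\<lambda>_. {0..c}) \<subseteq>
      (\<lambda>t. 0 + (\<Sum>b\<in>B. t b *\<^sub>R b)) -` cball 0 \<delta> \<inter> space (\<Pi>\<^sub>M b\<in>B. (lborel :: real measure))"
    by (auto simp: space_PiM PiE_iff)
  have "0 < (\<Prod>b\<in>B. emeasure lborel {0..c})" using c by (simp add: ennreal_power)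
  also have "\<dots> = emeasure (\<Pi>\<^sub>M b\<in>B. lborel) (Pi\<^sub>E B (\<lambda>_. {0..c}))"
    using fin by (intro P.emeasure_PiM[symmetric]) auto
  also have "\<dots> \<le> emeasure (\<Pi>\<^sub>M b\<in>B. lborel)
      ((\<lambda>t. 0 + (\<Sum>b\<in>B. t b *\<^sub>R b)) -` cball 0 \<delta> \<inter> space (\<Pi>\<^sub>M b\<in>B. (lborel :: real measure)))"
    by (rule emeasure_mono[OF sub]) measurable
  also have "\<dots> = emeasure (frame_measure 0 B) (cball 0 \<delta>)"
    unfolding frame_measure_def by (subst emeasure_distr) auto
  finally show ?thesis .
qed

section \<open>Gaussian integrals and integrability of powers\<close>

lemma gaussian_real:
  fixes a :: real
  assumes "a > 0"
  shows "integrable lborel (\<lambda>t. exp (- pi * a * t\<^sup>2))"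
    and "(LINT t|lborel. exp (- pi * a * t\<^sup>2)) = 1 / sqrt a"
proof -
  \<comment> \<open>The standard deviation for which the normal density is a multiple of the integrand.\<close>
  define \<sigma> where "\<sigma> = 1 / sqrt (2 * pi * a)"
  have \<sigma>: "\<sigma> > 0" "\<sigma>\<^sup>2 = 1 / (2 * pi * a)" using assms by (auto simp: \<sigma>_def power_divide)
  have eq: "exp (- pi * a * t\<^sup>2) = (1 / sqrt a) * normal_density 0 \<sigma> t" for t
    using assms by (simp add: normal_density_def \<sigma>(2) real_sqrt_divide field_simps)
  show "integrable lborel (\<lambda>t. exp (- pi * a * t\<^sup>2))"
    unfolding eq using \<sigma> by (intro integrable_mult_right integrable_normal_density) auto
  show "(LINT t|lborel. exp (- pi * a * t\<^sup>2)) = 1 / sqrt a"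
    unfolding eq using \<sigma> by simp
qed

text \<open>
  In coordinates with one axis along \<open>x\<close> the quadratic form is diagonal: its entry on that axis
  is $b + |x|^2$ and the other $m - 1$ entries are \<open>b\<close>. So the integral is a product of
  one-dimensional Gaussian integrals.
\<close>

lemma gaussian_frame_measure:
  fixes E :: "'a::euclidean_space set"
  assumes E: "orthonormal E" "E \<noteq> {}" and x: "x \<in> span E" and b: "b > 0"
  shows "integrable (frame_measure 0 E) (\<lambda>\<xi>. exp (- pi * (b * (norm \<xi>)\<^sup>2 + (x \<bullet> \<xi>)\<^sup>2)))" (is ?I)
    and "(LINT \<xi>|frame_measure 0 E. exp (- pi * (b * (norm \<xi>)\<^sup>2 + (x \<bullet> \<xi>)\<^sup>2)))
      = (1 / sqrt b) ^ (card E - 1) * (b + (norm x)\<^sup>2) powr - (1/2)" (is ?E)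
proof -
  interpret P: product_sigma_finite "\<lambda>_::'a. lborel :: real measure" by standard
  obtain e B where eB: "orthonormal (insert e B)" "e \<notin> B" "span (insert e B) = span E"
    "card (insert e B) = card E" "x = norm x *\<^sub>R e"
    using orthonormal_basis_containing_direction[OF E x] .
  let ?C = "insert e B"
  have fin: "finite ?C" by (rule orthonormal_finite[OF eB(1)])
  have M: "frame_measure 0 E = frame_measure 0 ?C"
    using frame_measure_cong_span eB(1,3) E(1) by metis
  define a where "a d = b + (if d = e then (norm x)\<^sup>2 else 0)" for d
  have a: "a d > 0" for d using b by (simp add: a_def add_pos_nonneg)
  have eq: "exp (- pi * (b * (norm (0 + (\<Sum>d\<in>?C. t d *\<^sub>R d)))\<^sup>2 + (x \<bullet> (0 + (\<Sum>d\<in>?C. t d *\<^sub>R d)))\<^sup>2))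
    = (\<Prod>d\<in>?C. exp (- pi * a d * (t d)\<^sup>2))" for t
  proof -
    have "x \<bullet> (\<Sum>d\<in>?C. t d *\<^sub>R d) = norm x * ((\<Sum>d\<in>?C. t d *\<^sub>R d) \<bullet> e)"
      by (subst eB(5)) (simp only: inner_scaleR_left inner_commute)
    also have "\<dots> = norm x * t e" using orthonormal_combination_inner[OF eB(1)] by auto
    finally have 1: "x \<bullet> (\<Sum>d\<in>?C. t d *\<^sub>R d) = norm x * t e" .
    have "(\<Sum>d\<in>?C. a d * (t d)\<^sup>2) = b * (\<Sum>d\<in>?C. (t d)\<^sup>2) + (\<Sum>d\<in>?C. if d = e then (norm x)\<^sup>2 * (t d)\<^sup>2 else 0)"
      unfolding a_def sum_distrib_left sum.distrib[symmetric]
      by (intro sum.cong refl) (simp add: algebra_simps)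
    also have "\<dots> = b * (norm (\<Sum>d\<in>?C. t d *\<^sub>R d))\<^sup>2 + (x \<bullet> (\<Sum>d\<in>?C. t d *\<^sub>R d))\<^sup>2"
      unfolding 1 orthonormal_combination_norm[OF eB(1)] using fin by (simp add: power_mult_distrib)
    finally have 2: "b * (norm (\<Sum>d\<in>?C. t d *\<^sub>R d))\<^sup>2 + (x \<bullet> (\<Sum>d\<in>?C. t d *\<^sub>R d))\<^sup>2
        = (\<Sum>d\<in>?C. a d * (t d)\<^sup>2)" ..
    show ?thesis
      unfolding add_0 2 by (simp only: exp_sum[OF fin, symmetric] sum_distrib_left mult.assoc)
  qed
  show ?I
    unfolding M
    by (subst integrable_frame_measure, measurable, unfold eq,
        intro P.product_integrable_prod fin gaussian_real a)
  have "(LINT \<xi>|frame_measure 0 E. exp (- pi * (b * (norm \<xi>)\<^sup>2 + (x \<bullet> \<xi>)\<^sup>2))) = (\<Prod>d\<in>?C. 1 / sqrt (a d))"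
    unfolding M
    by (subst integral_frame_measure, measurable, unfold eq,
        subst P.product_integral_prod) (use fin in \<open>auto simp: gaussian_real[OF a, simplified]\<close>)
  also have "\<dots> = 1 / sqrt (b + (norm x)\<^sup>2) * (\<Prod>d\<in>B. 1 / sqrt b)"
  proof -
    have "(\<Prod>d\<in>B. 1 / sqrt (a d)) = (\<Prod>d\<in>B. 1 / sqrt b)"
      using eB(2) by (intro prod.cong refl) (auto simp: a_def)
    then show ?thesis using fin eB(2) by (simp add: a_def)
  qed
  also have "\<dots> = (1 / sqrt b) ^ (card E - 1) * (b + (norm x)\<^sup>2) powr - (1/2)"
    using fin eB(2) b eB(4)[symmetric] by (simp add: powr_minus powr_half_sqrt inverse_eq_divide)
  finally show ?E .
qed

text \<open>
  On the half-line the integrand is at most a multiple of $(1 + t)^{-2q}$, which has an explicit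
  antiderivative.
\<close>

lemma integrable_decay_real:
  fixes q :: real
  assumes q: "q > 1/2"
  shows "integrable lborel (\<lambda>t::real. (1 + t\<^sup>2) powr - q)"
proof -
  let ?F = "\<lambda>t. (1 + t) powr (1 - 2*q) / (1 - 2*q)"
  have "((\<lambda>t::real. (1 + t) powr (1 - 2*q)) \<longlongrightarrow> 0) at_top"
    using q by (intro tendsto_neg_powr filterlim_tendsto_add_at_top[OF tendsto_const] filterlim_ident) auto
  from tendsto_divide[OF this tendsto_const[of "1 - 2*q"]]
  have lim: "(?F \<longlongrightarrow> 0) at_top" using q by simp
  have der: "DERIV ?F t :> (1 + t) powr (- 2*q)" if "t \<ge> 0" for t
    using that q by (auto intro!: derivative_eq_intros)
  have "(\<integral>\<^sup>+t. ennreal ((1 + t) powr (- 2*q)) * indicator {0..} t \<partial>lborel) = 0 - ?F 0"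
    by (rule nn_integral_FTC_atLeast[OF _ der _ lim]) auto
  then have fin: "(\<integral>\<^sup>+t. ennreal (indicator {0..} t * (1 + t) powr (- 2*q)) \<partial>lborel) < \<infinity>"
    by (simp add: ennreal_mult' ennreal_indicator mult.commute)
  have half: "integrable lborel (\<lambda>t. indicator {0..} t * (1 + t) powr (- 2*q) :: real)"
    by (rule integrableI_nonneg) (use fin in auto)
  have bd: "(1 + t\<^sup>2) powr - q \<le> 2 powr q * (1 + t) powr (- 2*q)" if "t \<ge> 0" for t :: real
  proof -
    have "((1 + t)\<^sup>2) powr q \<le> (2 * (1 + t\<^sup>2)) powr q"
    proof (rule powr_mono2)
      show "(1 + t)\<^sup>2 \<le> 2 * (1 + t\<^sup>2)"
        using zero_le_power2[of "1 - t"] by (simp add: power2_eq_square algebra_simps)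
    qed (use q in auto)
    then have "(1 + t) powr (2*q) \<le> 2 powr q * (1 + t\<^sup>2) powr q"
      using that powr_powr[of "1 + t" 2 q] unfolding powr_mult by simp
    moreover have "(1 + t\<^sup>2) powr q > 0" "(1 + t) powr (2*q) > 0"
      using that by (simp_all add: sum_power2_eq_zero_iff[of 1 t, simplified])
    ultimately show ?thesis by (simp add: powr_minus field_simps)
  qed
  have "integrable lborel (\<lambda>t. indicator {0..} t *\<^sub>R (1 + t\<^sup>2) powr - q)"
    by (rule Bochner_Integration.integrable_bound[OF integrable_mult_right[OF half, of "2 powr q"]])
       (use bd in \<open>auto simp: indicator_def\<close>)
  then have "has_bochner_integral lborel (\<lambda>t. (1 + t\<^sup>2) powr - q)
      (2 *\<^sub>R (LINT t|lborel. indicator {0..} t *\<^sub>R (1 + t\<^sup>2) powr - q))"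
    by (intro has_bochner_integral_even_function has_bochner_integral_integrable) auto
  then show ?thesis by (rule integrable.intros)
qed

text \<open>
  Since $1 + |x|^2 \ge 1 + x_e^2$ for each of the $m$ coordinates, writing the left side to the
  power $-q$ as a product of $m$ equal factors bounds it by $\prod_e (1 + x_e^2)^{-q/m}$. This
  avoids polar coordinates without loss in the exponent: $q/m > 1/2$ is the condition in
  dimension one.
\<close>

lemma integrable_frame_measure_decay:
  fixes E :: "'a::euclidean_space set"
  assumes E: "orthonormal E" "E \<noteq> {}" and q: "q > card E / 2"
  shows "integrable (frame_measure 0 E) (\<lambda>x. (1 + (norm x)\<^sup>2) powr - q)"
proof -
  interpret P: product_sigma_finite "\<lambda>_::'a. lborel :: real measure" by standard
  note fin = orthonormal_finite[OF E(1)]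
  have card: "card E > 0" using fin E(2) by (simp add: card_gt_0_iff)
  define s where "s = q / card E"
  have s: "s > 1/2" using q card by (simp add: s_def field_simps)
  have prod: "integrable (\<Pi>\<^sub>M e\<in>E. lborel) (\<lambda>t. \<Prod>e\<in>E. (1 + (t e)\<^sup>2) powr - s)"
    by (intro P.product_integrable_prod fin integrable_decay_real s)
  have "(1 + (norm (0 + (\<Sum>e\<in>E. t e *\<^sub>R e)))\<^sup>2) powr - q \<le> (\<Prod>e\<in>E. (1 + (t e)\<^sup>2) powr - s)" for t
  proof -
    let ?S = "\<Sum>e\<in>E. (t e)\<^sup>2"
    have S: "(t e)\<^sup>2 \<le> ?S" if "e \<in> E" for e
      using that fin by (intro member_le_sum) auto
    have "(1 + ?S) powr - q = (\<Prod>e\<in>E. (1 + ?S) powr - s)"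
    proof -
      have "1 + ?S > 0" by (simp add: sum_nonneg add_pos_nonneg)
      then have "((1 + ?S) powr - s) ^ card E = (1 + ?S) powr (- s * card E)"
        by (simp only: powr_realpow[symmetric] powr_gt_zero powr_powr less_imp_neq[symmetric] simp_thms)
      then show ?thesis using card by (simp add: s_def)
    qed
    also have "\<dots> \<le> (\<Prod>e\<in>E. (1 + (t e)\<^sup>2) powr - s)"
    proof (intro prod_mono conjI)
      fix e assume "e \<in> E"
      then show "(1 + ?S) powr - s \<le> (1 + (t e)\<^sup>2) powr - s"
        using S s by (intro powr_mono2') (auto intro: add_pos_nonneg)
    qed auto
    finally show ?thesis by (simp add: orthonormal_combination_norm[OF E(1)])
  qed
  then show ?thesis
    by (subst integrable_frame_measure, measurable)
       (rule Bochner_Integration.integrable_bound[OF prod],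
        auto intro!: AE_I2 intro: order_trans[OF _ abs_ge_self])
qed

section \<open>From hyperplane integrals to a potential\<close>

text \<open>
  On each hyperplane of the subspace orthogonal to \<open>\<xi>\<close> the factor \<open>\<phi> (x \<bullet> \<xi>)\<close> is constant, so
  Fubini along the direction of \<open>\<xi>\<close> reduces the integral to hyperplane integrals of \<open>f\<close>. For
  \<open>\<xi> = 0\<close> any direction of the subspace serves.
\<close>

lemma integral_ridge_eq_0:
  fixes E :: "'a::euclidean_space set" and f :: "'a \<Rightarrow> 'b::euclidean_space"
  assumes E: "orthonormal E" "E \<noteq> {}" and \<xi>: "\<xi> \<in> span E"
    and f[measurable]: "f \<in> borel_measurable borel" and \<phi>[measurable]: "\<phi> \<in> borel_measurable borel"
    and H: "\<And>e B t. \<lbrakk>orthonormal (insert e B); e \<notin> B; span (insert e B) = span E\<rbrakk>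
      \<Longrightarrow> integral\<^sup>L (frame_measure (t *\<^sub>R e) B) f = 0"
    and int: "integrable (frame_measure 0 E) (\<lambda>x. \<phi> (x \<bullet> \<xi>) *\<^sub>R f x)"
  shows "(LINT x|frame_measure 0 E. \<phi> (x \<bullet> \<xi>) *\<^sub>R f x) = 0"
proof -
  interpret P: product_sigma_finite "\<lambda>_::'a. lborel :: real measure" by standard
  obtain e B where eB: "orthonormal (insert e B)" "e \<notin> B" "span (insert e B) = span E"
    "card (insert e B) = card E" "\<xi> = norm \<xi> *\<^sub>R e"
    using orthonormal_basis_containing_direction[OF E \<xi>] .
  have fin: "finite B" using orthonormal_finite[OF eB(1)] by simp
  have M: "frame_measure 0 E = frame_measure 0 ({e} \<union> B)"
    using frame_measure_cong_span[OF E(1) eB(1)] eB(3) by simp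
  let ?h = "\<lambda>x. \<phi> (x \<bullet> \<xi>) *\<^sub>R f x"
  have hm[measurable]: "?h \<in> borel_measurable borel" by measurable
  have slice: "(LINT y|(\<Pi>\<^sub>M b\<in>B. lborel). ?h (0 + (\<Sum>b\<in>{e} \<union> B. merge {e} B (t, y) b *\<^sub>R b))) = 0" for t
  proof -
    have "(\<Sum>b\<in>{e} \<union> B. merge {e} B (t, y) b *\<^sub>R b) = t e *\<^sub>R e + (\<Sum>b\<in>B. y b *\<^sub>R b)" for y
    proof -
      have "(\<Sum>b\<in>B. merge {e} B (t, y) b *\<^sub>R b) = (\<Sum>b\<in>B. y b *\<^sub>R b)"
        using eB(2) by (intro sum.cong refl) (auto simp: merge_def)
      then show ?thesis using fin eB(2) by (simp add: merge_def)
    qed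
    moreover have "(t e *\<^sub>R e + (\<Sum>b\<in>B. y b *\<^sub>R b)) \<bullet> \<xi> = norm \<xi> * t e" for y
    proof -
      have "(\<Sum>b\<in>B. y b *\<^sub>R b) \<bullet> e = 0"
        using eB(1,2) by (auto simp: inner_sum_left orthonormal_def pairwise_insert orthogonal_def intro!: sum.neutral)
      moreover have "e \<bullet> e = 1" using eB(1) by (simp add: orthonormal_def norm_eq_1)
      ultimately have "(t e *\<^sub>R e + (\<Sum>b\<in>B. y b *\<^sub>R b)) \<bullet> e = t e" by (simp add: inner_add_left)
      then show ?thesis by (subst eB(5)) simp
    qed
    ultimately have "(LINT y|(\<Pi>\<^sub>M b\<in>B. lborel). ?h (0 + (\<Sum>b\<in>{e} \<union> B. merge {e} B (t, y) b *\<^sub>R b)))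
        = (LINT y|(\<Pi>\<^sub>M b\<in>B. lborel). \<phi> (norm \<xi> * t e) *\<^sub>R f (t e *\<^sub>R e + (\<Sum>b\<in>B. y b *\<^sub>R b)))"
      by simp
    also have "\<dots> = \<phi> (norm \<xi> * t e) *\<^sub>R integral\<^sup>L (frame_measure (t e *\<^sub>R e) B) f"
      by (simp add: integral_frame_measure)
    also have "\<dots> = 0" using H[OF eB(1-3)] by simp
    finally show ?thesis .
  qed
  have "integrable (Pi\<^sub>M ({e} \<union> B) (\<lambda>_. lborel)) (\<lambda>t. ?h (0 + (\<Sum>b\<in>{e} \<union> B. t b *\<^sub>R b)))"
    using int unfolding M by (subst (asm) integrable_frame_measure) measurable
  then have "(LINT t|(\<Pi>\<^sub>M b\<in>{e} \<union> B. lborel). ?h (0 + (\<Sum>b\<in>{e} \<union> B. t b *\<^sub>R b))) = 0"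
    using eB(2) fin by (subst P.product_integral_fold) (simp_all only: slice, auto)
  then show ?thesis
    unfolding M by (subst integral_frame_measure) measurable
qed

text \<open>
  The potential and zero arise from the two orders of integration in the double integral of
  $e^{-\pi (b |\xi|^2 + (x \cdot \xi)^2)} f(x)$. Integrating over \<open>\<xi>\<close> first gives a positive multiple of the
  potential; integrating over \<open>x\<close> first gives zero. The Gaussian kernel is positive, so absolute
  convergence of the double integral amounts to that of the potential, and it also gives the
  integrability of almost every slice.
\<close>

lemma potential_eq_0:
  fixes E :: "'a::euclidean_space set" and f :: "'a \<Rightarrow> 'b::euclidean_space"
  assumes E: "orthonormal E" "E \<noteq> {}" and b: "b > 0"
    and f[measurable]: "f \<in> borel_measurable borel"
    and H: "\<And>e B t. \<lbrakk>orthonormal (insert e B); e \<notin> B; span (insert e B) = span E\<rbrakk>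
      \<Longrightarrow> integral\<^sup>L (frame_measure (t *\<^sub>R e) B) f = 0"
    and int: "integrable (frame_measure 0 E) (\<lambda>x. (b + (norm x)\<^sup>2) powr - (1/2) *\<^sub>R f x)"
  shows "(LINT x|frame_measure 0 E. (b + (norm x)\<^sup>2) powr - (1/2) *\<^sub>R f x) = 0"
proof -
  let ?M = "frame_measure 0 E"
  interpret M: sigma_finite_measure ?M by (rule sigma_finite_frame_measure[OF E(1)])
  interpret MM: pair_sigma_finite ?M ?M ..
  define K where "K x \<xi> = exp (- pi * (b * (norm \<xi>)\<^sup>2 + (x \<bullet> \<xi>)\<^sup>2))" for x \<xi> :: 'a
  define C where "C = (1 / sqrt b) ^ (card E - 1)"
  have C: "C > 0" using b by (simp add: C_def)
  have Km[measurable]: "case_prod K \<in> borel_measurable (borel \<Otimes>\<^sub>M borel)"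
    unfolding K_def by measurable
  note gauss = gaussian_frame_measure[OF E _ b, folded K_def C_def]
  have span: "AE x in ?M. x \<in> span E" by (rule AE_frame_measure_span)
  have bM: "borel_measurable (?M \<Otimes>\<^sub>M ?M) = borel_measurable (borel \<Otimes>\<^sub>M borel)"
    by (intro measurable_cong_sets sets_pair_measure_cong) auto
  have Fub: "integrable (?M \<Otimes>\<^sub>M ?M) (\<lambda>(x, \<xi>). K x \<xi> *\<^sub>R f x)"
  proof (rule MM.Fubini_integrable)
    show "(\<lambda>(x, \<xi>). K x \<xi> *\<^sub>R f x) \<in> borel_measurable (?M \<Otimes>\<^sub>M ?M)"
      unfolding bM by measurable
    show "AE x in ?M. integrable ?M (\<lambda>\<xi>. case (x, \<xi>) of (x, \<xi>) \<Rightarrow> K x \<xi> *\<^sub>R f x)"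
      using span by eventually_elim (auto intro!: gauss)
    have "AE x in ?M. (LINT \<xi>|?M. norm (K x \<xi> *\<^sub>R f x))
        = C * norm ((b + (norm x)\<^sup>2) powr - (1/2) *\<^sub>R f x)"
      using span
    proof eventually_elim
      case (elim x)
      have "(LINT \<xi>|?M. norm (K x \<xi> *\<^sub>R f x)) = (LINT \<xi>|?M. K x \<xi>) * norm (f x)"
        by (simp add: K_def)
      then show ?case by (simp add: gauss elim)
    qed
    then have "integrable ?M (\<lambda>x. LINT \<xi>|?M. norm (K x \<xi> *\<^sub>R f x))
        \<longleftrightarrow> integrable ?M (\<lambda>x. C * norm ((b + (norm x)\<^sup>2) powr - (1/2) *\<^sub>R f x))"
      by (intro integrable_cong_AE M.borel_measurable_lebesgue_integral) (simp_all add: bM)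
    then show "integrable ?M (\<lambda>x. LINT \<xi>|?M. norm (case (x, \<xi>) of (x, \<xi>) \<Rightarrow> K x \<xi> *\<^sub>R f x))"
      using integrable_mult_right[OF integrable_norm[OF int], of C] by (simp only: prod.case)
  qed
  have "C *\<^sub>R (LINT x|?M. (b + (norm x)\<^sup>2) powr - (1/2) *\<^sub>R f x)
      = (LINT x|?M. C *\<^sub>R (b + (norm x)\<^sup>2) powr - (1/2) *\<^sub>R f x)"
    by (rule integral_scaleR_right[symmetric])
  also have "\<dots> = (LINT x|?M. LINT \<xi>|?M. K x \<xi> *\<^sub>R f x)"
  proof (rule integral_cong_AE)
    show "AE x in ?M. C *\<^sub>R (b + (norm x)\<^sup>2) powr - (1/2) *\<^sub>R f x = (LINT \<xi>|?M. K x \<xi> *\<^sub>R f x)"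
      using span by eventually_elim (simp add: gauss)
  qed (auto intro!: M.borel_measurable_lebesgue_integral simp: bM)
  also have "\<dots> = (LINT \<xi>|?M. LINT x|?M. K x \<xi> *\<^sub>R f x)"
    by (rule MM.Fubini_integral[OF Fub, symmetric])
  also have "\<dots> = 0"
  proof (rule integral_eq_zero_AE)
    show "AE \<xi> in ?M. (LINT x|?M. K x \<xi> *\<^sub>R f x) = 0"
      using span MM.AE_integrable_snd[OF Fub]
    proof eventually_elim
      case (elim \<xi>)
      have K: "K x \<xi> *\<^sub>R f x = (\<lambda>t. exp (- pi * (b * (norm \<xi>)\<^sup>2 + t\<^sup>2))) (x \<bullet> \<xi>) *\<^sub>R f x" for x
        by (simp add: K_def)
      show ?case
        using elim(2) unfolding K by (intro integral_ridge_eq_0[OF E elim(1) f _ H]) auto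
    qed
  qed
  finally show ?thesis using C by simp
qed

section \<open>Concentration at the origin\<close>

text \<open>
  The new integral is, up to the factor \<open>- s\<close>, the derivative in \<open>b\<close> of the old one. The
  difference quotients of the power to the right of \<open>b\<close> are bounded by its derivative at \<open>b\<close>
  because that derivative decreases in absolute value, and
  $(b + u)^{-s-1} \le b^{-1} (b + u)^{-s}$ provides an integrable majorant.
\<close>

lemma shifted_power_integral_eq_0_Suc:
  fixes f :: "'a \<Rightarrow> 'b::{banach, second_countable_topology}" and u :: "'a \<Rightarrow> real"
  assumes u: "\<And>x. u x \<ge> 0" and s: "s > 0"
    and um[measurable]: "u \<in> borel_measurable M" and f[measurable]: "f \<in> borel_measurable M"
    and I: "\<And>b. b > 0 \<Longrightarrow> has_bochner_integral M (\<lambda>x. (b + u x) powr - s *\<^sub>R f x) 0"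
    and b: "b > 0"
  shows "has_bochner_integral M (\<lambda>x. (b + u x) powr - (s + 1) *\<^sub>R f x) 0"
proof -
  define h where "h n = 1 / real (Suc n)" for n
  have h: "h n > 0" for n by (simp add: h_def)
  have "h \<longlonglongrightarrow> 0"
    using LIMSEQ_inverse_real_of_nat by (simp only: h_def[abs_def] inverse_eq_divide)
  then have h0: "filterlim h (at 0) sequentially"
    unfolding filterlim_at using h
    by (auto intro!: always_eventually less_imp_neq[symmetric])
  define D where "D n x = ((b + h n + u x) powr - s - (b + u x) powr - s) / h n" for n x
  have der: "((\<lambda>c. (c + u x) powr - s) has_real_derivative - s * (c + u x) powr - (s + 1)) (at c)"
    if "c > 0" for c x
    using that u[of x] by (auto intro!: derivative_eq_intros simp: add_pos_nonneg)
  have lim: "(\<lambda>n. D n x) \<longlonglongrightarrow> - s * (b + u x) powr - (s + 1)" for x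
    using der[OF b, of x] unfolding DERIV_def
    by (auto dest!: filterlim_compose[OF _ h0] simp: D_def)
  have bound: "\<bar>D n x\<bar> \<le> s * (b + u x) powr - (s + 1)" for n x
  proof -
    obtain z where z: "b < z" "z < b + h n"
      "(b + h n + u x) powr - s - (b + u x) powr - s = (b + h n - b) * (- s * (z + u x) powr - (s + 1))"
      using MVT2[of b "b + h n" "\<lambda>c. (c + u x) powr - s" "\<lambda>c. - s * (c + u x) powr - (s + 1)"] der h[of n] b
      by auto
    have "\<bar>D n x\<bar> = s * (z + u x) powr - (s + 1)"
      using z(3) h[of n] s by (simp add: D_def abs_mult)
    also have "\<dots> \<le> s * (b + u x) powr - (s + 1)"
      using z b s u[of x] by (intro mult_left_mono powr_mono2') auto
    finally show ?thesis .
  qed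
  have step: "(b + u x) powr - (s + 1) \<le> (b + u x) powr - s / b" for x
  proof -
    have "(b + u x) powr - (s + 1) = (b + u x) powr - s / (b + u x)"
      using b u[of x] by (simp add: powr_diff)
    also have "\<dots> \<le> (b + u x) powr - s / b"
      using b u[of x] by (intro divide_left_mono) auto
    finally show ?thesis .
  qed
  have int: "integrable M (\<lambda>x. (b + u x) powr - (s + 1) *\<^sub>R f x)"
  proof (rule Bochner_Integration.integrable_bound)
    show "integrable M (\<lambda>x. (1 / b) *\<^sub>R (b + u x) powr - s *\<^sub>R f x)"
      using I[OF b] by (intro integrable_scaleR_right) (rule integrable.intros)
    show "AE x in M. norm ((b + u x) powr - (s + 1) *\<^sub>R f x) \<le> norm ((1 / b) *\<^sub>R (b + u x) powr - s *\<^sub>R f x)"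
    proof (rule AE_I2)
      fix x
      show "norm ((b + u x) powr - (s + 1) *\<^sub>R f x) \<le> norm ((1 / b) *\<^sub>R (b + u x) powr - s *\<^sub>R f x)"
        using mult_right_mono[OF step[of x] norm_ge_zero[of "f x"]] b by simp
    qed
  qed measurable
  have "(\<lambda>n. LINT x|M. D n x *\<^sub>R f x) \<longlonglongrightarrow> (LINT x|M. (- s * (b + u x) powr - (s + 1)) *\<^sub>R f x)"
  proof (rule integral_dominated_convergence)
    show "integrable M (\<lambda>x. s * norm ((b + u x) powr - (s + 1) *\<^sub>R f x))"
      using int by (intro integrable_mult_right integrable_norm)
    show "AE x in M. (\<lambda>n. D n x *\<^sub>R f x) \<longlonglongrightarrow> (- s * (b + u x) powr - (s + 1)) *\<^sub>R f x"
      using lim by (intro AE_I2 tendsto_scaleR tendsto_const)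
    show "AE x in M. norm (D n x *\<^sub>R f x) \<le> s * norm ((b + u x) powr - (s + 1) *\<^sub>R f x)" for n
      using bound[of n] by (auto intro!: AE_I2 mult_right_mono simp: mult.assoc[symmetric])
  qed (auto simp: D_def)
  moreover have "(LINT x|M. D n x *\<^sub>R f x) = 0" for n
  proof -
    have "has_bochner_integral M (\<lambda>x. (1 / h n) *\<^sub>R ((b + h n + u x) powr - s *\<^sub>R f x - (b + u x) powr - s *\<^sub>R f x))
        ((1 / h n) *\<^sub>R (0 - 0))"
      using b h[of n] by (intro has_bochner_integral_scaleR_right has_bochner_integral_diff I) auto
    then show ?thesis
      by (simp add: has_bochner_integral_integral_eq D_def divide_inverse scaleR_diff_left scaleR_diff_right algebra_simps)
  qed
  ultimately have "(LINT x|M. (- s * (b + u x) powr - (s + 1)) *\<^sub>R f x) = 0"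
    by (simp add: LIMSEQ_const_iff)
  then have "(- s) *\<^sub>R (LINT x|M. (b + u x) powr - (s + 1) *\<^sub>R f x) = 0"
    by (subst integral_scaleR_right[symmetric]) (simp only: scaleR_scaleR)
  then show ?thesis using int s by (simp add: has_bochner_integral_iff)
qed

text \<open>
  If \<open>f 0\<close> were not zero, \<open>\<phi> x = f 0 \<bullet> f x\<close> would be positive on a ball of radius \<open>\<delta>\<close>. The weights
  are rescaled to $G_j = ((1 + \delta^2) / (1 + |x|^2))^j (1 + |x|^2)^{-1/2}$. On the ball
  $G_j \ge G_0$, so there the integral of $G_j \varphi$ stays above a positive constant; outside,
  $G_j$ tends to zero below $G_0$, so the remaining part tends to zero. Hence the whole integral
  cannot be zero for every \<open>j\<close>.
\<close>

lemma concentration_eq_0: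
  fixes f :: "'a::euclidean_space \<Rightarrow> 'b::euclidean_space"
  assumes M: "sets M = sets borel"
    and pos: "\<And>\<delta>. \<delta> > 0 \<Longrightarrow> emeasure M (cball 0 \<delta>) > 0"
    and f[measurable]: "f \<in> borel_measurable borel" and cont: "isCont f 0"
    and I: "\<And>j::nat. has_bochner_integral M (\<lambda>x. (1 + (norm x)\<^sup>2) powr - (1/2 + j) *\<^sub>R f x) 0"
  shows "f 0 = 0"
proof (rule ccontr)
  note [measurable_cong] = M
  assume nz: "f 0 \<noteq> 0"
  define \<phi> where "\<phi> x = f 0 \<bullet> f x" for x
  have [measurable]: "\<phi> \<in> borel_measurable borel" unfolding \<phi>_def by measurable
  have "isCont \<phi> 0" unfolding \<phi>_def by (intro continuous_intros cont)
  moreover have "\<phi> 0 > 0" using nz by (simp add: \<phi>_def)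
  ultimately have "eventually (\<lambda>x. \<phi> x > 0) (at 0)"
    by (simp add: isCont_def order_tendstoD)
  then obtain d where d: "d > 0" "\<And>x. norm x < d \<Longrightarrow> \<phi> x > 0"
    using \<open>\<phi> 0 > 0\<close> unfolding eventually_at by (auto simp: dist_norm) metis
  define \<delta> where "\<delta> = d / 2"
  have \<delta>: "\<delta> > 0" "\<And>x. norm x \<le> \<delta> \<Longrightarrow> \<phi> x > 0" using d by (auto simp: \<delta>_def)
  define G where "G j x = ((1 + \<delta>\<^sup>2) / (1 + (norm x)\<^sup>2)) ^ j * (1 + (norm x)\<^sup>2) powr - (1/2)" for j and x :: 'a
  have [measurable]: "G j \<in> borel_measurable borel" for j unfolding G_def by measurable
  have G_I: "has_bochner_integral M (\<lambda>x. G j x * \<phi> x) 0" for j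
  proof -
    have G: "G j x = (1 + \<delta>\<^sup>2) ^ j * (1 + (norm x)\<^sup>2) powr - (1/2 + j)" for x
    proof -
      have "(1 + (norm x)\<^sup>2) powr - (1/2 + j) = (1 + (norm x)\<^sup>2) powr - (1/2) / (1 + (norm x)\<^sup>2) ^ j"
        by (subst powr_realpow[symmetric]) (auto simp: add_pos_nonneg powr_diff[symmetric])
      then show ?thesis by (simp add: G_def power_divide)
    qed
    have "has_bochner_integral M (\<lambda>x. (1 + \<delta>\<^sup>2) ^ j * (f 0 \<bullet> ((1 + (norm x)\<^sup>2) powr - (1/2 + j) *\<^sub>R f x)))
        ((1 + \<delta>\<^sup>2) ^ j * (f 0 \<bullet> 0))"
      by (intro has_bochner_integral_mult_right has_bochner_integral_inner_right I)
    then show ?thesis by (simp add: G \<phi>_def mult.assoc del: powr_minus)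
  qed
  have int0: "integrable M (\<lambda>x. G 0 x * \<phi> x)" using G_I by (rule integrable.intros)
  \<comment> \<open>A lower bound of \<open>G j x * \<phi> x\<close> with the integrable majorant \<open>\<bar>G 0 x * \<phi> x\<bar>\<close>, and its limit in \<open>j\<close>.\<close>
  define \<psi> where "\<psi> j x = (if norm x \<le> \<delta> then G 0 x * \<phi> x else G j x * \<phi> x)" for j x
  define \<omega> where "\<omega> x = (if norm x \<le> \<delta> then G 0 x * \<phi> x else 0)" for x
  have [measurable]: "\<psi> j \<in> borel_measurable M" for j unfolding \<psi>_def by measurable
  have [measurable]: "\<omega> \<in> borel_measurable M" unfolding \<omega>_def by measurable
  have ratio: "(1 + \<delta>\<^sup>2) / (1 + (norm x)\<^sup>2) < 1" "0 \<le> (1 + \<delta>\<^sup>2) / (1 + (norm x)\<^sup>2)"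
    if "\<not> norm x \<le> \<delta>" for x :: 'a
    using that \<delta>(1) by (auto simp: add_pos_nonneg intro!: power_strict_mono divide_nonneg_nonneg)
  have bound: "\<bar>\<psi> j x\<bar> \<le> \<bar>G 0 x * \<phi> x\<bar>" for j x
  proof (cases "norm x \<le> \<delta>")
    case False
    have "\<bar>G j x\<bar> \<le> \<bar>G 0 x\<bar>"
      using ratio[OF False] unfolding G_def by (auto simp: abs_mult intro!: mult_left_le_one_le power_le_one)
    then show ?thesis using False by (simp add: \<psi>_def abs_mult mult_right_mono)
  qed (simp add: \<psi>_def)
  have le: "\<psi> j x \<le> G j x * \<phi> x" for j x
  proof (cases "norm x \<le> \<delta>")
    case True
    have "1 \<le> (1 + \<delta>\<^sup>2) / (1 + (norm x)\<^sup>2)"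
      using True by (simp add: add_pos_nonneg power_mono)
    then have "G 0 x \<le> G j x"
      using mult_right_mono[OF one_le_power powr_ge_zero, of "(1 + \<delta>\<^sup>2) / (1 + (norm x)\<^sup>2)"]
      by (simp add: G_def)
    then show ?thesis using True \<delta>(2)[OF True] by (simp add: \<psi>_def mult_right_mono)
  qed (simp add: \<psi>_def)
  have lim: "(\<lambda>j. \<psi> j x) \<longlonglongrightarrow> \<omega> x" for x
  proof (cases "norm x \<le> \<delta>")
    case False
    have "(\<lambda>j. ((1 + \<delta>\<^sup>2) / (1 + (norm x)\<^sup>2)) ^ j * ((1 + (norm x)\<^sup>2) powr - (1/2) * \<phi> x)) \<longlonglongrightarrow> 0"
      by (intro tendsto_mult_left_zero LIMSEQ_realpow_zero ratio False)
    then show ?thesis using False by (simp add: \<psi>_def \<omega>_def G_def mult.assoc)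
  qed (simp add: \<psi>_def \<omega>_def)
  have int\<psi>: "integrable M (\<psi> j)" for j
    by (rule Bochner_Integration.integrable_bound[OF int0]) (use bound in auto)
  have int\<omega>: "integrable M \<omega>"
    by (rule Bochner_Integration.integrable_bound[OF int0]) (auto simp: \<omega>_def)
  have "(\<lambda>j. integral\<^sup>L M (\<psi> j)) \<longlonglongrightarrow> integral\<^sup>L M \<omega>"
    by (rule integral_dominated_convergence[where w="\<lambda>x. \<bar>G 0 x * \<phi> x\<bar>"])
       (use lim bound int0 in auto)
  moreover have "integral\<^sup>L M (\<psi> j) \<le> 0" for j
  proof -
    have "integral\<^sup>L M (\<psi> j) \<le> (LINT x|M. G j x * \<phi> x)"
      using G_I[of j] by (intro integral_mono int\<psi> le) (rule integrable.intros)
    also have "\<dots> = 0" using G_I by (rule has_bochner_integral_integral_eq)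
    finally show ?thesis .
  qed
  ultimately have "integral\<^sup>L M \<omega> \<le> 0" by (intro LIMSEQ_le_const2) auto
  moreover have \<omega>0: "\<omega> x \<ge> 0" for x
    using \<delta>(2)[of x] by (auto simp: \<omega>_def G_def intro!: mult_nonneg_nonneg)
  ultimately have "integral\<^sup>L M \<omega> = 0" by (intro antisym integral_nonneg_AE) auto
  then have \<omega>_AE: "AE x in M. \<omega> x = 0"
    using integral_nonneg_eq_0_iff_AE[OF int\<omega>] \<omega>0 by simp
  have \<omega>_pos: "\<omega> x > 0" if "x \<in> cball 0 \<delta>" for x
  proof -
    have "1 + (norm x)\<^sup>2 \<noteq> 0" by (metis add_pos_nonneg less_irrefl zero_le_power2 zero_less_one)
    then show ?thesis using that \<delta>(2)[of x] by (auto simp: \<omega>_def G_def)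
  qed
  have "AE x in M. x \<notin> cball 0 \<delta>"
    using \<omega>_AE
  proof eventually_elim
    case (elim x)
    then show ?case using \<omega>_pos[of x] by linarith
  qed
  then have "emeasure M (cball 0 \<delta>) = 0"
    by (subst (asm) AE_iff_measurable[of "cball 0 \<delta>"]) (auto simp: M sets_eq_imp_space_eq[OF M])
  with pos[OF \<delta>(1)] show False by simp
qed

section \<open>Injectivity and the support theorem\<close>

text \<open>
  The affine hyperplanes of \<open>span E\<close> are the sets $t e + \mathrm{span}\, B$ with
  \<open>insert e B\<close> an orthonormal basis of \<open>span E\<close>. Applied to the translates of \<open>f\<close>, the conclusion
  says that \<open>f\<close> vanishes on a whole affine plane. The bound on \<open>lam\<close> is what makes
  $f(x) (b + |x|^2)^{-1/2}$, which decays to the order $\lambda + 1$, integrable over \<open>span E\<close>.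
\<close>

theorem hyperplane_transform_injective:
  fixes E :: "'a::euclidean_space set" and f :: "'a \<Rightarrow> 'b::euclidean_space"
  assumes E: "orthonormal E" "E \<noteq> {}"
    and cont: "continuous_on UNIV f"
    and lam: "lam > real (card E) - 1"
    and decay: "\<And>x. x \<in> span E \<Longrightarrow> norm (f x) \<le> C * (1 + (norm x)\<^sup>2) powr - (lam/2)"
    and H: "\<And>e B t. \<lbrakk>orthonormal (insert e B); e \<notin> B; span (insert e B) = span E\<rbrakk>
      \<Longrightarrow> integral\<^sup>L (frame_measure (t *\<^sub>R e) B) f = 0"
  shows "f 0 = 0"
proof (rule concentration_eq_0)
  let ?M = "frame_measure 0 E"
  show f[measurable]: "f \<in> borel_measurable borel"
    using cont by (rule borel_measurable_continuous_onI)
  have int: "integrable ?M (\<lambda>x. (b + (norm x)\<^sup>2) powr - (1/2) *\<^sub>R f x)" if b: "b > 0" for b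
  proof (rule Bochner_Integration.integrable_bound)
    show "integrable ?M (\<lambda>x. (min 1 b powr - (1/2) * C) * (1 + (norm x)\<^sup>2) powr - ((lam + 1)/2))"
      using lam by (intro integrable_mult_right integrable_frame_measure_decay[OF E]) auto
    show "AE x in ?M. norm ((b + (norm x)\<^sup>2) powr - (1/2) *\<^sub>R f x)
        \<le> norm ((min 1 b powr - (1/2) * C) * (1 + (norm x)\<^sup>2) powr - ((lam + 1)/2))"
      using AE_frame_measure_span
    proof eventually_elim
      case (elim x)
      let ?y = "(norm x)\<^sup>2"
      have "min 1 b * (1 + ?y) \<le> b + ?y"
        using b mult_right_mono[of "min 1 b" 1 ?y] by (simp add: distrib_left)
      then have "(b + ?y) powr - (1/2) \<le> (min 1 b * (1 + ?y)) powr - (1/2)"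
        using b by (intro powr_mono2') (auto intro!: mult_pos_pos add_pos_nonneg)
      also have "\<dots> = min 1 b powr - (1/2) * (1 + ?y) powr - (1/2)"
        using b by (intro powr_mult)
      finally have 1: "(b + ?y) powr - (1/2) \<le> min 1 b powr - (1/2) * (1 + ?y) powr - (1/2)" .
      have "norm ((b + ?y) powr - (1/2) *\<^sub>R f x) = (b + ?y) powr - (1/2) * norm (f x)" by simp
      also have "\<dots> \<le> (min 1 b powr - (1/2) * (1 + ?y) powr - (1/2)) * (C * (1 + ?y) powr - (lam/2))"
        by (intro mult_mono 1 decay elim) auto
      also have "\<dots> = (min 1 b powr - (1/2) * C) * ((1 + ?y) powr - (1/2) * (1 + ?y) powr - (lam/2))"
        by (simp only: ac_simps)
      also have "(1 + ?y) powr - (1/2) * (1 + ?y) powr - (lam/2) = (1 + ?y) powr - ((lam + 1)/2)"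
        unfolding powr_add[symmetric] by (rule arg_cong[where f="\<lambda>s. (1 + ?y) powr s"]) (simp add: field_simps)
      finally show ?case by simp
    qed
  qed measurable
  have "has_bochner_integral ?M (\<lambda>x. (b + (norm x)\<^sup>2) powr - (1/2 + real j) *\<^sub>R f x) 0" if "b > 0" for b j
    using that
  proof (induction j arbitrary: b)
    case 0
    have "(LINT x|?M. (b + (norm x)\<^sup>2) powr - (1/2) *\<^sub>R f x) = 0"
      by (rule potential_eq_0[OF E 0 f H int[OF 0]])
    then show ?case using int[OF 0] unfolding has_bochner_integral_iff of_nat_0 add_0_right by blast
  next
    case (Suc j)
    have "has_bochner_integral ?M (\<lambda>x. (b + (norm x)\<^sup>2) powr - (1/2 + real j + 1) *\<^sub>R f x) 0"
      by (rule shifted_power_integral_eq_0_Suc) (use Suc in auto)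
    moreover have "1/2 + real j + 1 = 1/2 + real (Suc j)" by simp
    ultimately show ?case by (simp only:)
  qed
  then show "has_bochner_integral ?M (\<lambda>x. (1 + (norm x)\<^sup>2) powr - (1/2 + real j) *\<^sub>R f x) 0" for j
    by simp
  show "isCont f 0" using cont by (simp add: continuous_on_eq_continuous_at)
  show "emeasure ?M (cball 0 \<delta>) > 0" if "\<delta> > 0" for \<delta>
    by (rule emeasure_frame_measure_cball_pos[OF E(1) that])
qed simp

text \<open>
  The hypothesis $k < n - 1$ leaves room in the orthogonal complement of \<open>p\<close> for a subspace of
  dimension $k + 1$.
\<close>

theorem theorem5p2:
  fixes k :: nat
    and g :: "real ^ 'n \<Rightarrow> complex"
    and lam c r :: real
  assumes "1 \<le> k" and "k < CARD('n) - 1"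
    and "continuous_on UNIV g"
    and "lam > real k"
    and "\<forall>x. norm x powr lam * norm (g x) \<le> c"
    and "r > 0"
    and "\<forall>\<zeta>\<in>affine_Grassmannian k. infdist 0 \<zeta> > r \<longrightarrow> plane_transform g \<zeta> = 0"
  shows "\<forall>x. norm x > r \<longrightarrow> g x = 0"
proof (intro allI impI)
  fix p :: "real ^ 'n" assume p: "norm p > r"
  with assms(6) have p0: "norm p > 0" by linarith
  have [measurable]: "g \<in> borel_measurable borel"
    using assms(3) by (rule borel_measurable_continuous_onI)
  obtain D where D: "pairwise orthogonal D" "\<And>x. x \<in> D \<Longrightarrow> norm x = 1" "independent D"
      "card D = dim {y. p \<bullet> y = 0}" "span D = {y. p \<bullet> y = 0}"
    using orthonormal_basis_subspace[OF subspace_hyperplane[of p]] by metis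
  have "dim {y. p \<bullet> y = 0} = CARD('n) - 1"
    using p0 by (subst dim_hyperplane) auto
  then obtain E where E: "E \<subseteq> D" "card E = Suc k"
    using D(4) assms(2) obtain_subset_with_card_n[of "Suc k" D] by auto
  have on: "orthonormal E" using D(1,2) E(1)
    by (auto simp: orthonormal_def intro: pairwise_mono)
  have perp: "p \<bullet> y = 0" if "y \<in> span E" for y
    using span_mono[OF E(1)] that D(5) by auto
  have norm_p: "(norm (p + y))\<^sup>2 = (norm p)\<^sup>2 + (norm y)\<^sup>2" if "y \<in> span E" for y
    using perp[OF that] by (simp add: power2_norm_eq_inner inner_add inner_commute)
  define f where "f x = g (p + x)" for x
  have "f 0 = 0"
  proof (rule hyperplane_transform_injective[OF on])
    show "E \<noteq> {}" using E(2) by auto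
    show "continuous_on UNIV f"
      unfolding f_def by (intro continuous_on_compose2[OF assms(3)] continuous_intros) auto
    show "lam > real (card E) - 1" using assms(4) E(2) by simp
    \<comment> \<open>As \<open>x\<close> is orthogonal to \<open>p\<close>, the norm of \<open>p + x\<close> is bounded below by multiples of both 1 and \<open>norm x\<close>.\<close>
    let ?m = "min 1 ((norm p)\<^sup>2)"
    show "norm (f x) \<le> (c * ?m powr - (lam/2)) * (1 + (norm x)\<^sup>2) powr - (lam/2)"
      if x: "x \<in> span E" for x
    proof -
      let ?y = "(norm x)\<^sup>2"
      have m: "?m > 0" using p0 by simp
      have "?m * (1 + ?y) \<le> (norm p)\<^sup>2 + ?y"
        using mult_right_mono[of ?m 1 ?y] by (simp add: distrib_left)
      then have "(?m * (1 + ?y)) powr (lam/2) \<le> ((norm (p + x))\<^sup>2) powr (lam/2)"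
        unfolding norm_p[OF x] using assms(4) m by (intro powr_mono2) auto
      also have "\<dots> = norm (p + x) powr lam"
        by (simp add: powr_powr flip: powr_numeral)
      finally have "(?m * (1 + ?y)) powr (lam/2) * norm (f x) \<le> norm (p + x) powr lam * norm (f x)"
        by (intro mult_right_mono) auto
      also have "\<dots> \<le> c" using assms(5) by (simp add: f_def)
      finally have "?m powr (lam/2) * (1 + ?y) powr (lam/2) * norm (f x) \<le> c"
        using m by (simp add: powr_mult)
      moreover have "?m powr (lam/2) > 0" "(1 + ?y) powr (lam/2) > 0"
        using m by (simp_all add: add_pos_nonneg less_imp_neq[symmetric])
      moreover have "N \<le> c * inverse A * inverse B" if "A * B * N \<le> c" "A > 0" "B > 0" for A B N :: real
        using that by (simp add: field_simps)
      ultimately show ?thesis unfolding powr_minus by blast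
    qed
    fix e B t
    assume eB: "orthonormal (insert e B)" "e \<notin> B" "span (insert e B) = span E"
    define \<zeta> where "\<zeta> = (+) (p + t *\<^sub>R e) ` span B"
    have onB: "orthonormal B" using orthonormal_subset[OF eB(1)] by auto
    have "card B = k"
      using eB orthonormal_independent[OF eB(1)] orthonormal_independent[OF on]
        orthonormal_finite[OF onB] E(2)
      by (metis card_insert_disjoint dim_eq_card_independent dim_span nat.inject)
    then have dim: "aff_dim \<zeta> = int k"
      using orthonormal_independent[OF onB]
      by (simp add: \<zeta>_def aff_dim_translation_eq aff_dim_subspace dim_eq_card_independent)
    moreover have "affine \<zeta>"
      unfolding \<zeta>_def using affine_translation subspace_imp_affine[OF subspace_span] by blast
    ultimately have G: "\<zeta> \<in> affine_Grassmannian k" by (simp add: affine_Grassmannian_def)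
    \<comment> \<open>The point of \<open>p + span E\<close> nearest to the origin is \<open>p\<close>.\<close>
    have "norm p \<le> infdist 0 \<zeta>"
    proof -
      have "norm p \<le> dist 0 z" if z: "z \<in> \<zeta>" for z
      proof -
        obtain y where y: "y \<in> span B" "z = p + (t *\<^sub>R e + y)" using z unfolding \<zeta>_def image_iff add.assoc by blast
        have "t *\<^sub>R e + y \<in> span E"
          unfolding eB(3)[symmetric] using y(1) span_mono[of B "insert e B"]
          by (intro span_add span_scale) (auto intro: span_base)
        from norm_p[OF this] have "(norm p)\<^sup>2 \<le> (norm z)\<^sup>2" unfolding y(2) by simp
        then show ?thesis by (simp add: power2_le_iff_abs_le)
      qed
      moreover have "\<zeta> \<noteq> {}" using span_zero by (auto simp: \<zeta>_def)
      ultimately show ?thesis by (auto simp: infdist_def intro!: cINF_greatest)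
    qed
    then have "plane_transform g \<zeta> = 0" using assms(7) G p by auto
    moreover have "plane_frame \<zeta> (p + t *\<^sub>R e) B"
      using onB by (simp add: plane_frame_def \<zeta>_def orthonormal_def)
    ultimately have "integral\<^sup>L (frame_measure (p + t *\<^sub>R e) B) g = 0"
      by (simp add: plane_transform_def plane_measure_eq)
    then show "integral\<^sup>L (frame_measure (t *\<^sub>R e) B) f = 0"
      unfolding f_def by (subst integral_frame_measure_translate) auto
  qed
  then show "g p = 0" by (simp add: f_def)
qed

end
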